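(* Let $n\ge 1$ be an integer with $n\neq 6$, let $G=S_n$, let $F$ be a field containing a primitive $n$-th root of $1$, and let $r=\sum_{C\in\mathcal K(G)} r_C C$ be a ramification of $G$. Let ${\cal N}(G,r)$ be the number of isomorphism classes in the set $\Omega(G,r)$ of all ramification systems with characters (RSC's) of $G$ with ramification $r$. Then $${\cal N}(G,r)=\prod_{C\in\mathcal K_r(G)}\binom{\gamma_C+r_C-1}{r_C}.$$
   Context: For a finite group $G$, $\mathcal K(G)$ is the set of conjugacy classes of $G$, $Z_x$ is the centralizer of $x\in G$, and $\widehat H$ denotes the set of group homomorphisms $H\to F\setminus\{0\}$ (characters of one-dimensional representations over $F$). A ramification of $G$ is a formal sum $r=\sum_{C\in\mathcal K(G)}r_C C$ with each $r_C$ a non-negative integer. For each $C$ a set $I_C(r)$ with $|I_C(r)|=r_C$ is fixed, and $\mathcal K_r(G)=\{C\in\mathcal K(G): r_C\neq 0\}$. A ramification system with characters (RSC) is a quadruple $(G,r,\overrightarrow{\chi},u)$ where $r$ is a ramification of $G$, $u:\mathcal K(G)\to G$ is a map with $u(C)\in C$ for every $C\in\mathcal K(G)$, and $\overrightarrow{\chi}=\{\chi_C^{(i)}\}_{i\in I_C(r),\,C\in\mathcal K_r(G)}$ is a family with $\chi_C^{(i)}\in\widehat{Z_{u(C)}}$. Two RSC's $(G,r,\overrightarrow{\chi},u)$ and $(G',r',\overrightarrow{\chi'},u')$ are isomorphic if: (i) there is a group isomorphism $\phi:G\to G'$; (ii) for every $C\in\mathcal K(G)$ there is $h_C\in G$ with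 $\phi(h_Cu(C)h_C^{-1})=u'(\phi(C))$; (iii) for every $C\in\mathcal K_r(G)$ there is a bijection $\phi_C:I_C(r)\to I_{\phi(C)}(r')$ such that $\chi_{\phi(C)}^{\prime(\phi_C(i))}(\phi(h_Chh_C^{-1}))=\chi_C^{(i)}(h)$ for all $h\in Z_{u(C)}$ and all $i\in I_C(r)$ (with the same $\phi$ and $h_C$ as in (i), (ii)). For a fixed ramification $r$ of $G$, $\Omega(G,r)$ is the set of all RSC's $(G,r,\overrightarrow{\chi},u)$. For $C\in\mathcal K(S_n)$ of cycle type $1^{\lambda_1}2^{\lambda_2}\cdots n^{\lambda_n}$ ($\lambda_i$ cycles of length $i$, including fixed points for $i=1$) and $\sigma\in C$, the paper states $|\widehat{Z_\sigma}|=\left(\prod_{\lambda_i=1}i\right)\left(\prod_{\lambda_i\ge 2}2i\right)$ and denotes this number by $\gamma_C$; it depends only on $C$. Empty products equal $1$.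
   Formalization: γ_C is taken as the number of characters of Z_σ over F; its closed form is claimed only if F has primitive i-th roots of 1 for all cycle lengths i, and -1≠1 if some λ_i≥2. A primitive n-th root alone is not enough: n=3, F=GF(4), r={id} gives N=1, not 2. *)

theory Defs
  imports
    "HOL-Algebra.Sym_Groups"
    "HOL-Algebra.Multiplicative_Group"
    "HOL-Combinatorics.Orbits"
begin

definition conj_class :: "('g, 'b) monoid_scheme \<Rightarrow> 'g \<Rightarrow> 'g set" where
  "conj_class G x = {g \<otimes>\<^bsub>G\<^esub> x \<otimes>\<^bsub>G\<^esub> inv\<^bsub>G\<^esub> g | g. g \<in> carrier G}"

definition conj_classes :: "('g, 'b) monoid_scheme \<Rightarrow> 'g set set" where
  "conj_classes G = conj_class G ` carrier G"

definition centralizer :: "('g, 'b) monoid_scheme \<Rightarrow> 'g \<Rightarrow> 'g set" where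
  "centralizer G x = {g \<in> carrier G. g \<otimes>\<^bsub>G\<^esub> x = x \<otimes>\<^bsub>G\<^esub> g}"

text \<open>Characters of the subgroup \<open>H\<close> of \<open>G\<close>, i.e. homomorphisms from \<open>H\<close> to the multiplicative
  group of \<open>F\<close>. They are taken to be extensional, so that each homomorphism is counted once.\<close>

definition characters ::
  "('f, 'c) ring_scheme \<Rightarrow> ('g, 'b) monoid_scheme \<Rightarrow> 'g set \<Rightarrow> ('g \<Rightarrow> 'f) set" where
  "characters F G H =
     hom (G\<lparr>carrier := H\<rparr>) (Multiplicative_Group.mult_of F) \<inter> extensional H"

definition primitive_root :: "('f, 'c) ring_scheme \<Rightarrow> nat \<Rightarrow> 'f \<Rightarrow> bool" where
  "primitive_root F m z \<longleftrightarrow> z \<in> carrier F \<and> z [^]\<^bsub>F\<^esub> m = \<one>\<^bsub>F\<^esub> \<and>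
     (\<forall>k. 0 < k \<and> k < m \<longrightarrow> z [^]\<^bsub>F\<^esub> k \<noteq> \<one>\<^bsub>F\<^esub>)"


text \<open>The formal sum \<open>\<Sum>C. r\<^sub>C C\<close> is represented by its coefficient function.\<close>

definition ramifications :: "('g, 'b) monoid_scheme \<Rightarrow> ('g set \<Rightarrow> nat) set" where
  "ramifications G = (conj_classes G \<rightarrow>\<^sub>E UNIV)"

definition ramified_classes :: "('g, 'b) monoid_scheme \<Rightarrow> ('g set \<Rightarrow> nat) \<Rightarrow> 'g set set" where
  "ramified_classes G r = {C \<in> conj_classes G. r C \<noteq> 0}"

text \<open>A choice of index sets \<open>I C\<close> of cardinality \<open>r C\<close>; it is a fixed parameter of the
  notions below.\<close>

definition index_sets ::
  "('g, 'b) monoid_scheme \<Rightarrow> ('g set \<Rightarrow> nat) \<Rightarrow> ('g set \<Rightarrow> 'i set) \<Rightarrow> bool" where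
  "index_sets G r I \<longleftrightarrow> (\<forall>C \<in> conj_classes G. finite (I C) \<and> card (I C) = r C)"

text \<open>Quadruples \<open>(G, r, \<chi>, u)\<close>, where \<open>\<chi> C i\<close> is the character of index \<open>i\<close> attached
  to the class \<open>C\<close>.\<close>

type_synonym ('g, 'i, 'f) quadruple =
  "'g monoid \<times> ('g set \<Rightarrow> nat) \<times> ('g set \<Rightarrow> 'i \<Rightarrow> 'g \<Rightarrow> 'f) \<times> ('g set \<Rightarrow> 'g)"

fun is_RSC ::
  "('f, 'c) ring_scheme \<Rightarrow> ('g set \<Rightarrow> 'i set) \<Rightarrow> ('g, 'i, 'f) quadruple \<Rightarrow> bool" where
  "is_RSC F I (G, r, \<chi>, u) \<longleftrightarrow>
     group G \<and> finite (carrier G) \<and> r \<in> ramifications G \<and> index_sets G r I \<and>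
     u \<in> (\<Pi>\<^sub>E C \<in> conj_classes G. C) \<and>
     \<chi> \<in> (\<Pi>\<^sub>E C \<in> ramified_classes G r. \<Pi>\<^sub>E i \<in> I C. characters F G (centralizer G (u C)))"

text \<open>\<open>I\<close> and \<open>I'\<close> are the index sets of the first and of the second system; the image of a
  class \<open>C\<close> under \<open>\<phi>\<close> is \<open>\<phi> ` C\<close>.\<close>

fun RSC_isomorphic ::
  "('g set \<Rightarrow> 'i set) \<Rightarrow> ('h set \<Rightarrow> 'j set) \<Rightarrow>
     ('g, 'i, 'f) quadruple \<Rightarrow> ('h, 'j, 'f) quadruple \<Rightarrow> bool" where
  "RSC_isomorphic I I' (G, r, \<chi>, u) (G', r', \<chi>', u') \<longleftrightarrow>
     (\<exists>\<phi> \<in> iso G G'. \<exists>h \<in> conj_classes G \<rightarrow> carrier G.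
        (\<forall>C \<in> conj_classes G. \<phi> (h C \<otimes>\<^bsub>G\<^esub> u C \<otimes>\<^bsub>G\<^esub> inv\<^bsub>G\<^esub> (h C)) = u' (\<phi> ` C)) \<and>
        (\<forall>C \<in> ramified_classes G r. \<exists>\<psi>. bij_betw \<psi> (I C) (I' (\<phi> ` C)) \<and>
           (\<forall>i \<in> I C. \<forall>x \<in> centralizer G (u C).
              \<chi>' (\<phi> ` C) (\<psi> i) (\<phi> (h C \<otimes>\<^bsub>G\<^esub> x \<otimes>\<^bsub>G\<^esub> inv\<^bsub>G\<^esub> (h C))) = \<chi> C i x)))"

definition RSCs ::
  "('f, 'c) ring_scheme \<Rightarrow> ('g set \<Rightarrow> 'i set) \<Rightarrow> 'g monoid \<Rightarrow> ('g set \<Rightarrow> nat) \<Rightarrow>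
     ('g, 'i, 'f) quadruple set" where
  "RSCs F I G r = {(G, r, \<chi>, u) | \<chi> u. is_RSC F I (G, r, \<chi>, u)}"

definition num_RSC_classes ::
  "('f, 'c) ring_scheme \<Rightarrow> ('g set \<Rightarrow> 'i set) \<Rightarrow> 'g monoid \<Rightarrow> ('g set \<Rightarrow> nat) \<Rightarrow> nat" where
  "num_RSC_classes F I G r =
     card (RSCs F I G r // {(R, R') \<in> RSCs F I G r \<times> RSCs F I G r. RSC_isomorphic I I R R'})"


text \<open>The number \<open>\<gamma>\<^sub>C\<close> of characters of the centralizer of an element of \<open>C\<close>; centralizers of
  conjugate elements are conjugate, so the choice of the element does not matter.\<close>

definition gamma :: "('f, 'c) ring_scheme \<Rightarrow> ('g, 'b) monoid_scheme \<Rightarrow> 'g set \<Rightarrow> nat" where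
  "gamma F G C = card (characters F G (centralizer G (SOME \<sigma>. \<sigma> \<in> C)))"

text \<open>The number \<open>\<lambda>\<^sub>i\<close> of cycles of length \<open>i\<close> of a permutation \<open>\<sigma>\<close> of \<open>{1..n}\<close>, fixed points
  being cycles of length 1.\<close>

definition num_cycles :: "nat \<Rightarrow> (nat \<Rightarrow> nat) \<Rightarrow> nat \<Rightarrow> nat" where
  "num_cycles n \<sigma> i = card {c \<in> Orbits.orbit \<sigma> ` {1..n}. card c = i}"

text \<open>Exactly the roots of unity in \<open>F\<close> needed for the closed form of \<open>\<gamma>\<^sub>C\<close>, \<open>\<sigma> \<in> C\<close>: a character of
  the centralizer of \<open>\<sigma>\<close> sends each cycle of length \<open>i\<close> to an \<open>i\<close>-th root of unity, and an
  exchange of two cycles of equal length to a square root of unity. A primitive \<open>n\<close>-th root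
  of unity in \<open>F\<close> alone does not provide these: over the rationals with a primitive fifth
  root of unity adjoined, the centralizer of a 3-cycle in \<open>S\<^sub>5\<close> has 2 characters, not 6.\<close>

definition has_enough_roots ::
  "('f, 'c) ring_scheme \<Rightarrow> nat \<Rightarrow> (nat \<Rightarrow> nat) \<Rightarrow> bool" where
  "has_enough_roots F n \<sigma> \<longleftrightarrow>
     (\<forall>i \<in> {1..n}. num_cycles n \<sigma> i \<ge> 1 \<longrightarrow> (\<exists>z. primitive_root F i z)) \<and>
     ((\<exists>i \<in> {1..n}. num_cycles n \<sigma> i \<ge> 2) \<longrightarrow> (\<exists>z. primitive_root F 2 z))"

end

theory Submission
  imports Defs "HOL-Algebra.Polynomial_Divisibility" "HOL-Number_Theory.Cong"
begin

text \<open>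
For \<open>n \<noteq> 6\<close> every automorphism of the symmetric group \<open>S\<^sub>n\<close> is inner. An isomorphism between two
ramification systems of \<open>S\<^sub>n\<close> therefore maps every conjugacy class \<open>C\<close> to itself and amounts to a
choice, separately for each \<open>C\<close>, of an element that conjugates \<open>u C\<close> to \<open>u' C\<close> and of a bijection
of the indices compatible with it. Two such elements differ by an element of a centralizer, and a
character, whose values commute, does not change under inner automorphisms of its own group. So all
characters at \<open>C\<close> can be transported to the centralizer of one fixed representative of \<open>C\<close>, without
any ambiguity, and two systems are isomorphic if and only if they yield the same multisets of
characters there. Every family of multisets of sizes \<open>r\<^sub>C\<close> occurs, and there are
\<open>\<gamma>\<^sub>C + r\<^sub>C - 1\<close> choose \<open>r\<^sub>C\<close> multisets of size \<open>r\<^sub>C\<close> in a set of \<open>\<gamma>\<^sub>C\<close> characters. For any finite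
group all of whose automorphisms are inner, this is \<open>num_RSC_classes_eq\<close>.

That automorphisms are inner (\<open>sym_automorphism.inner\<close>) is shown without counting conjugacy classes.
The product of two transpositions has order at most 3, and a transposition on at least three points
does not commute with all its conjugates; for \<open>n \<noteq> 6\<close> any other involution violates one of these
properties (\<open>involution_conjugates\<close>). An automorphism thus permutes the transpositions. It preserves
whether two of them commute, hence maps the star of all \<open>(s i)\<close> with fixed \<open>s\<close> to another star,
and the correspondence of the two stars is the conjugating permutation.

For the number \<open>\<gamma>\<^sub>C\<close> of characters of the centralizer of \<open>\<sigma>\<close> (\<open>card_chars\<close>), note that the
centralizer is generated by the single cycles of \<open>\<sigma>\<close> and the exchanges of two cycles of equal
length (\<open>cent_induct\<close>), and that for each length all these cycles are conjugate, and all these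
exchanges. A character is therefore given by one \<open>i\<close>-th root of unity for each length \<open>i\<close>
that occurs, and one square root of unity for each length that occurs at least twice. Conversely,
all such values are attained: the total rotation modulo \<open>i\<close> of the cycles of length \<open>i\<close> and the sign
of their permutation are additive, and can serve as exponents of arbitrary roots of unity.\<close>

section \<open>Involutions in symmetric groups\<close>

lemma transpose_conj:
  assumes "bij g"
  shows "g \<circ> Transposition.transpose a b \<circ> inv' g = Transposition.transpose (g a) (g b)"
proof
  fix x
  obtain y where x: "x = g y" using assms by (metis bij_pointE)
  have "inj g" using assms by (rule bij_is_inj)
  then show "(g \<circ> Transposition.transpose a b \<circ> inv' g) x = Transposition.transpose (g a) (g b) x"
    unfolding x by (simp add: Transposition.transpose_def inj_eq)
qed

lemma transpose_commute_iff:
  assumes "a \<noteq> b" "c \<noteq> d"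
  shows "Transposition.transpose a b \<circ> Transposition.transpose c d =
           Transposition.transpose c d \<circ> Transposition.transpose a b
         \<longleftrightarrow> {a, b} = {c, d} \<or> {a, b} \<inter> {c, d} = {}" (is "?L \<longleftrightarrow> ?R")
proof
  assume L: ?L
  have 1: "Transposition.transpose a b (Transposition.transpose c d x) =
           Transposition.transpose c d (Transposition.transpose a b x)" for x
    using L by (metis comp_apply)
  show ?R
    using 1[of a] 1[of b] 1[of c] 1[of d] assms
    by (auto simp: Transposition.transpose_def split: if_splits)
next
  assume ?R
  then show ?L by (auto simp: fun_eq_iff Transposition.transpose_def doubleton_eq_iff)
qed

lemma transpose_eq_imp_eq_set:
  assumes "Transposition.transpose a b = Transposition.transpose c d" "a \<noteq> b"
  shows "{a, b} = {c, d}"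
proof -
  have cd: "c \<noteq> d" using assms by (metis transpose_apply_first transpose_same id_apply)
  have "x \<in> {a, b} \<longleftrightarrow> Transposition.transpose a b x \<noteq> x" for x
    using assms(2) by (auto simp: Transposition.transpose_def)
  moreover have "x \<in> {c, d} \<longleftrightarrow> Transposition.transpose c d x \<noteq> x" for x
    using cd by (auto simp: Transposition.transpose_def)
  ultimately show ?thesis using assms(1) by (metis (no_types, lifting) subsetI subset_antisym)
qed

text \<open>Two transpositions are equal, or disjoint, or generate a symmetric group on three points; their
product therefore has order 1, 2 or 3, and 6 is a common multiple.\<close>

lemma transpose_prod_pow_6:
  "(Transposition.transpose a b \<circ> Transposition.transpose c d) ^^ 6 = id"
proof -
  have three: "((Transposition.transpose a b \<circ> Transposition.transpose a d) ^^ 6) x = x"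
    if "a \<noteq> b" "a \<noteq> d" "b \<noteq> d" for a b d x :: 'a
  proof -
    consider "x = a" | "x = b" | "x = d" | "x \<noteq> a" "x \<noteq> b" "x \<noteq> d" by blast
    then show ?thesis
      using that that[symmetric] by cases (simp_all add: numeral_eq_Suc transpose_apply_other)
  qed
  have same: "((Transposition.transpose a b \<circ> Transposition.transpose a b) ^^ 6) x = x" for a b x :: 'a
    by (simp add: numeral_eq_Suc)
  have triv: "(Transposition.transpose a b ^^ 6) x = x" for a b x :: 'a
    by (simp add: numeral_eq_Suc)
  have "((Transposition.transpose a b \<circ> Transposition.transpose c d) ^^ 6) x = x" for x
  proof (cases "a = b \<or> c = d \<or> {a, b} \<inter> {c, d} = {}")
    case True
    then consider "a = b" | "c = d" | "a \<noteq> b" "c \<noteq> d" "{a, b} \<inter> {c, d} = {}" by blast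
    then show ?thesis
    proof cases
      case 3
      then have "Transposition.transpose a b (Transposition.transpose c d y)
               = Transposition.transpose c d (Transposition.transpose a b y)" for y
        using transpose_commute_iff[of a b c d] by (metis comp_apply)
      then show ?thesis by (simp add: numeral_eq_Suc)
    qed (simp_all add: triv[simplified id_def])
  next
    case False
    then consider "c = a" | "c = b" | "d = a" | "d = b" by blast
    then show ?thesis
      using False three[of a b d] three[of b a d] three[of a b c] three[of b a c] same[of a b] same[of b a]
      by cases (metis transpose_commute)+
  qed
  then show ?thesis by (simp add: fun_eq_iff)
qed

lemma ex_notin_if_card_less:
  assumes "finite A" "card A < card S"
  shows "\<exists>x\<in>S. x \<notin> A"
  using assms by (meson card_mono leD subsetI)

text \<open>This tells transpositions apart from the other involutions in terms of the group alone: a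
transposition on at least three points has a conjugate that does not commute with it, and all its
products with conjugates have order dividing 6. The involutions that are excluded here by
\<open>card S = 6\<close> are the products of three disjoint transpositions of six points, where the products
of conjugates again only have orders 1, 2 and 3; these are the images of the transpositions under
the outer automorphisms.\<close>

lemma involution_conjugates:
  assumes S: "finite S" and p: "p permutes S" and pp: "\<And>x. p (p x) = x"
    and "p \<noteq> id" and nt: "\<And>a b. a \<noteq> b \<Longrightarrow> p \<noteq> Transposition.transpose a b"
    and "card S \<noteq> 6"
  shows "4 \<le> card S \<and>
     ((\<exists>g. g permutes S \<and> (p \<circ> (g \<circ> p \<circ> inv' g)) ^^ 6 \<noteq> id) \<or>
     (\<forall>g. g permutes S \<longrightarrow> p \<circ> (g \<circ> p \<circ> inv' g) = (g \<circ> p \<circ> inv' g) \<circ> p))"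
proof -
  have inS: "p x \<in> S \<longleftrightarrow> x \<in> S" for x using p by (simp add: permutes_in_image)
  obtain a where a: "p a \<noteq> a" using \<open>p \<noteq> id\<close> by (auto simp: fun_eq_iff)
  define b where "b = p a"
  have "p \<noteq> Transposition.transpose a b" using nt[of a b] a unfolding b_def by metis
  then obtain c where c0: "p c \<noteq> Transposition.transpose a b c" by (auto simp: fun_eq_iff)
  define d where "d = p c"
  have c: "c \<noteq> a" "c \<noteq> b" "d \<noteq> c"
    using c0 pp by (auto simp: b_def d_def Transposition.transpose_def split: if_splits)
  have pv: "p a = b" "p b = a" "p c = d" "p d = c" by (simp_all add: pp b_def d_def)
  have dd: "d \<noteq> a" "d \<noteq> b" "a \<noteq> b" using c a pv by metis+
  have abS: "a \<in> S" "b \<in> S" "c \<in> S" "d \<in> S"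
    using pv dd c p by (metis permutes_not_in)+
  have "card {a, b, c, d} = 4" using c dd by auto
  then have card4: "4 \<le> card S" using card_mono[of S "{a,b,c,d}"] abS S by auto
  have conj: "(g \<circ> p \<circ> inv' g) (g x) = g (p x)" if "g permutes S" for g x
    using that by (simp add: permutes_inverses)
  consider (fp) e where "e \<in> S" "p e = e" | (four) "card S = 4" "\<And>x. x \<in> S \<Longrightarrow> p x \<noteq> x"
    | (big) "card S \<noteq> 4" "\<And>x. x \<in> S \<Longrightarrow> p x \<noteq> x" by blast
  then have "(\<exists>g. g permutes S \<and> (p \<circ> (g \<circ> p \<circ> inv' g)) ^^ 6 \<noteq> id) \<or>
     (\<forall>g. g permutes S \<longrightarrow> p \<circ> (g \<circ> p \<circ> inv' g) = (g \<circ> p \<circ> inv' g) \<circ> p)"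
  proof cases
    case fp
    \<comment> \<open>The conjugate \<open>q\<close> is \<open>p\<close> moved one step along the path \<open>a, b, c, d, e\<close>; the two
      involutions then alternate along this path, and \<open>p \<circ> q\<close> has the 5-cycle \<open>(a b d e c)\<close>.\<close>
    define g where "g = cycle_of_list [a, b, c, d, e]"
    have ne: "e \<noteq> a" "e \<noteq> b" "e \<noteq> c" "e \<noteq> d" using fp pv dd c by auto
    have g: "g permutes S" unfolding g_def
      by (rule permutes_subset[OF cycle_permutes]) (use abS fp in auto)
    have gv: "g a = b" "g b = c" "g c = d" "g d = e" "g e = a"
      using ne c dd by (auto simp: g_def Transposition.transpose_def)
    define q where "q = g \<circ> p \<circ> inv' g"
    have qv: "q a = a" "q b = c" "q c = b" "q d = e" "q e = d"
      using conj[OF g, of e] conj[OF g, of a] conj[OF g, of b] conj[OF g, of c] conj[OF g, of d]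
      by (simp_all add: q_def gv pv fp)
    have "((p \<circ> q) ^^ 6) a = b"
      by (simp add: numeral_eq_Suc qv pv fp)
    then have "(p \<circ> q) ^^ 6 \<noteq> id" using dd by auto
    then show ?thesis using g unfolding q_def by blast
  next
    case four
    \<comment> \<open>On four points, two different matchings \<open>p\<close> and \<open>q\<close> send \<open>x\<close>, in either order, to the
      fourth point: they are two of the three involutions of the Klein four-group.\<close>
    have "p (q x) = q (p x)" if q: "q permutes S" "\<And>x. q (q x) = x" "\<And>x. x \<in> S \<Longrightarrow> q x \<noteq> x"
      and x: "x \<in> S" for q x
    proof (cases "p x = q x")
      case True then show ?thesis by (metis pp q(2))
    next
      case False
      have qS: "q x \<in> S" "q (p x) \<in> S" "p (q x) \<in> S" "p x \<in> S"
        using x q(1) inS by (simp_all add: permutes_in_image)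
      have d3: "card {x, p x, q x} = 3" using False four(2)[OF x] q(3)[OF x] by auto
      have "card (S - {x, p x, q x}) = 1"
        using d3 four(1) qS x by (subst card_Diff_subset) auto
      then obtain w where w: "S - {x, p x, q x} = {w}" by (auto simp: card_1_singleton_iff)
      have "p (q x) \<noteq> x" "p (q x) \<noteq> p x" "p (q x) \<noteq> q x"
        using False pp q four(2) qS(1) x by (metis, metis, metis)
      moreover have "q (p x) \<noteq> x" "q (p x) \<noteq> p x" "q (p x) \<noteq> q x"
        using False pp q(2,3) four(2) qS(4) x by (metis, metis, metis)
      ultimately have "p (q x) \<in> {w}" "q (p x) \<in> {w}"
        unfolding w[symmetric] using qS by auto
      then show ?thesis by simp
    qed
    note comm = this
    have "p \<circ> (g \<circ> p \<circ> inv' g) = (g \<circ> p \<circ> inv' g) \<circ> p" if g: "g permutes S" for g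
    proof (rule ext)
      fix x
      define q where "q = g \<circ> p \<circ> inv' g"
      have q: "q permutes S" unfolding q_def
        using g p by (intro permutes_compose permutes_inv)
      have "q (q x) = x" for x
        unfolding q_def using g by (simp add: permutes_inverses pp)
      moreover have "q x \<noteq> x" if "x \<in> S" for x
        unfolding q_def o_apply
        using four(2)[of "inv' g x"] that g permutes_inv[OF g]
        by (metis permutes_in_image permutes_inverses(2))
      ultimately have "p (q x) = q (p x)"
        using comm[OF q, of x] permutes_not_in[OF q, of x] permutes_not_in[OF q, of "p x"]
          permutes_not_in[OF p, of x] inS by (cases "x \<in> S") auto
      then show "(p \<circ> (g \<circ> p \<circ> inv' g)) x = ((g \<circ> p \<circ> inv' g) \<circ> p) x"
        unfolding q_def by simp
    qed
    then show ?thesis by blast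
  next
    case big
    \<comment> \<open>There are at least eight points, hence four 2-cycles of \<open>p\<close>. Moving \<open>p\<close> one step around an
      octagon through them gives a \<open>q\<close> for which \<open>p \<circ> q\<close> has the 4-cycle \<open>(a h e c)\<close>.\<close>
    have "card {a, b, c, d} < card S" using big card4 \<open>card {a,b,c,d} = 4\<close> by simp
    then obtain e where e: "e \<in> S" "e \<notin> {a, b, c, d}"
      using ex_notin_if_card_less[of "{a, b, c, d}" S] by auto
    define f where "f = p e"
    have pf: "p e = f" "p f = e" by (simp_all add: f_def pp)
    have e': "e \<noteq> a" "e \<noteq> b" "e \<noteq> c" "e \<noteq> d" using e by auto
    have f': "f \<noteq> e" "f \<noteq> a" "f \<noteq> b" "f \<noteq> c" "f \<noteq> d"
      using big(2)[OF e(1)] e' pf pv by metis+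
    have fS: "f \<in> S" using e(1) inS[of e] pf by simp
    have "card {a, b, c, d, e, f} = 6" using c dd e' f' by simp
    then have "card {a, b, c, d, e, f} < card S"
      using card_mono[of S "{a,b,c,d,e,f}"] abS S e(1) fS \<open>card S \<noteq> 6\<close> by simp
    then obtain h where h: "h \<in> S" "h \<notin> {a, b, c, d, e, f}"
      using ex_notin_if_card_less[of "{a, b, c, d, e, f}" S] by auto
    define k where "k = p h"
    have pk: "p h = k" "p k = h" by (simp_all add: k_def pp)
    have h': "h \<noteq> a" "h \<noteq> b" "h \<noteq> c" "h \<noteq> d" "h \<noteq> e" "h \<noteq> f" using h by auto
    have k': "k \<noteq> h" "k \<noteq> a" "k \<noteq> b" "k \<noteq> c" "k \<noteq> d" "k \<noteq> e" "k \<noteq> f"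
      using big(2)[OF h(1)] h' pf pv pk by metis+
    have kS: "k \<in> S" using h(1) inS[of h] pk by simp
    define g where "g = cycle_of_list [a, b, c, d, e, f, h, k]"
    have g: "g permutes S" unfolding g_def
      by (rule permutes_subset[OF cycle_permutes]) (use abS e(1) fS h(1) kS in auto)
    have gv: "g a = b" "g b = c" "g c = d" "g d = e" "g e = f" "g f = h" "g h = k" "g k = a"
      using c dd e' f' h' k' by (simp_all add: g_def Transposition.transpose_def)
    define q where "q = g \<circ> p \<circ> inv' g"
    have qv: "q b = c" "q c = b" "q d = e" "q e = d" "q f = h" "q h = f" "q k = a" "q a = k"
      using conj[OF g, of a] conj[OF g, of b] conj[OF g, of c] conj[OF g, of d]
        conj[OF g, of e] conj[OF g, of f] conj[OF g, of h] conj[OF g, of k]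
      by (simp_all add: q_def gv pv pf pk)
    have "((p \<circ> q) ^^ 6) a = e"
      by (simp add: numeral_eq_Suc qv pv pf pk)
    then have "(p \<circ> q) ^^ 6 \<noteq> id" using e' by auto
    then show ?thesis using g unfolding q_def by blast
  qed
  with card4 show ?thesis by blast
qed

section \<open>Automorphisms of symmetric groups\<close>

locale sym_automorphism =
  fixes S :: "'a set" and \<phi> :: "('a \<Rightarrow> 'a) \<Rightarrow> ('a \<Rightarrow> 'a)"
  assumes fin: "finite S"
    and bij: "bij_betw \<phi> {p. p permutes S} {p. p permutes S}"
    and mult: "\<And>p q. p permutes S \<Longrightarrow> q permutes S \<Longrightarrow> \<phi> (p \<circ> q) = \<phi> p \<circ> \<phi> q"
begin

lemma permutes_image: "p permutes S \<Longrightarrow> \<phi> p permutes S"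
  using bij unfolding bij_betw_def by auto

lemma eq_iff: "p permutes S \<Longrightarrow> q permutes S \<Longrightarrow> \<phi> p = \<phi> q \<longleftrightarrow> p = q"
  using bij unfolding bij_betw_def inj_on_def by auto

lemma surj: "q permutes S \<Longrightarrow> \<exists>p. p permutes S \<and> \<phi> p = q"
  using bij unfolding bij_betw_def by (metis (mono_tags, lifting) imageE mem_Collect_eq)

lemma one: "\<phi> id = id"
proof -
  have "\<phi> id \<circ> \<phi> id = \<phi> id" using mult[OF permutes_id permutes_id] by simp
  then show ?thesis
    using permutes_image[OF permutes_id] by (metis comp_id fun.map_id o_assoc permutes_inv_o(2))
qed

lemma funpow: assumes "p permutes S" shows "\<phi> (p ^^ k) = \<phi> p ^^ k"
proof (induction k)
  case 0 show ?case by (simp add: one[unfolded id_def] id_def)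
next
  case (Suc k)
  then show ?case using mult[OF assms permutes_funpow[OF assms]] by (metis funpow.simps(2))
qed

lemma inv: assumes "p permutes S" shows "\<phi> (inv' p) = inv' (\<phi> p)"
proof -
  have "\<phi> (inv' p) \<circ> \<phi> p = id"
    using mult[OF permutes_inv[OF assms] assms] assms by (simp add: permutes_inv_o one)
  then show ?thesis
    using permutes_inv_o(1)[OF permutes_image[OF assms]] by (metis comp_id id_comp o_assoc)
qed

lemma conj: "p permutes S \<Longrightarrow> g permutes S \<Longrightarrow> \<phi> (g \<circ> p \<circ> inv' g) = \<phi> g \<circ> \<phi> p \<circ> inv' (\<phi> g)"
  by (simp add: mult inv permutes_compose permutes_inv)

text \<open>The image of a transposition is an involution that inherits the two properties of transpositions
which \<open>involution_conjugates\<close> denies to all other involutions.\<close>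

lemma transpose_image:
  assumes "card S \<noteq> 6" and ab: "a \<in> S" "b \<in> S" "a \<noteq> b"
  shows "\<exists>c\<in>S. \<exists>d\<in>S. c \<noteq> d \<and> \<phi> (Transposition.transpose a b) = Transposition.transpose c d"
proof -
  define t where "t = Transposition.transpose a b"
  have t: "t permutes S" unfolding t_def using ab by (simp add: permutes_swap_id)
  define p where "p = \<phi> t"
  have p: "p permutes S" unfolding p_def by (rule permutes_image[OF t])
  have "p \<circ> p = id" unfolding p_def using mult[OF t t] one by (simp add: t_def)
  then have pp: "p (p x) = x" for x by (metis comp_apply id_apply)
  have "t \<noteq> id" using ab by (metis id_apply t_def transpose_apply_first)
  then have "p \<noteq> id" unfolding p_def using eq_iff[OF t permutes_id] one by simp
  have "\<exists>c d. c \<noteq> d \<and> p = Transposition.transpose c d"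
  proof (rule ccontr)
    assume "\<not> ?thesis"
    then have nt: "c \<noteq> d \<Longrightarrow> p \<noteq> Transposition.transpose c d" for c d by blast
    note * = involution_conjugates[OF fin p pp \<open>p \<noteq> id\<close> nt \<open>card S \<noteq> 6\<close>]
    have "card {a, b} < card S" using conjunct1[OF *] ab by simp
    then obtain c where c: "c \<in> S" "c \<notin> {a, b}"
      using ex_notin_if_card_less[of "{a, b}" S] by auto
    from * consider g where "g permutes S" "(p \<circ> (g \<circ> p \<circ> inv' g)) ^^ 6 \<noteq> id"
      | "\<And>g. g permutes S \<Longrightarrow> p \<circ> (g \<circ> p \<circ> inv' g) = (g \<circ> p \<circ> inv' g) \<circ> p" by blast
    then show False
    proof cases
      case 1
      obtain h where h: "h permutes S" "\<phi> h = g" using surj 1 by blast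
      define t' where "t' = h \<circ> t \<circ> inv' h"
      have t': "t' permutes S" unfolding t'_def using t h(1) by (intro permutes_compose permutes_inv)
      have "t' = Transposition.transpose (h a) (h b)"
        unfolding t'_def t_def using permutes_bij[OF h(1)] by (rule transpose_conj)
      then have "(t \<circ> t') ^^ 6 = id"
        unfolding t_def by (simp only: transpose_prod_pow_6)
      moreover have "\<phi> ((t \<circ> t') ^^ 6) = \<phi> (t \<circ> t') ^^ 6"
        by (rule funpow[OF permutes_compose[OF t' t]])
      moreover have "\<phi> (t \<circ> t') = p \<circ> (g \<circ> p \<circ> inv' g)"
        unfolding mult[OF t t'] unfolding t'_def conj[OF t h(1)] h(2) p_def ..
      ultimately show False using 1(2) one by metis
    next
      case 2
      define g where "g = Transposition.transpose b c"
      have g: "g permutes S" unfolding g_def using ab c by (simp add: permutes_swap_id)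
      have ct: "g \<circ> t \<circ> inv' g = Transposition.transpose a c"
      proof -
        have "g a = a" "g b = c"
          using ab c by (auto simp: g_def transpose_apply_other)
        then show ?thesis unfolding t_def transpose_conj[OF permutes_bij[OF g]] by simp
      qed
      have g': "g \<circ> t \<circ> inv' g permutes S" using t g by (intro permutes_compose permutes_inv)
      have "\<phi> (t \<circ> (g \<circ> t \<circ> inv' g)) = \<phi> ((g \<circ> t \<circ> inv' g) \<circ> t)"
        unfolding mult[OF t g'] mult[OF g' t] conj[OF t g]
        using 2[OF permutes_image[OF g]] unfolding p_def .
      then have "t \<circ> (g \<circ> t \<circ> inv' g) = (g \<circ> t \<circ> inv' g) \<circ> t"
        using eq_iff t g' permutes_compose by meson
      then show False unfolding ct unfolding t_def
        using transpose_commute_iff[of a b a c] ab c by auto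
    qed
  qed
  then obtain c d where cd: "c \<noteq> d" "p = Transposition.transpose c d" by blast
  have "c \<in> S" using cd p permutes_not_in[of p S c] by (auto simp del: permutes_not_in)
  moreover have "d \<in> S" using cd p permutes_not_in[of p S d] by (auto simp del: permutes_not_in)
  ultimately show ?thesis using cd unfolding p_def t_def by blast
qed

text \<open>The transpositions \<open>(s i)\<close> form a star in the complete graph on \<open>S\<close>. No two of them commute, so
any two of their images share exactly one point. Edges that meet pairwise form a star or a
triangle.\<close>

lemma ex_star_centre:
  assumes "card S \<noteq> 6" and s: "s \<in> S"
  shows "\<exists>a\<in>S. \<forall>i\<in>S - {s}. \<exists>b\<in>S - {a}.
           \<phi> (Transposition.transpose s i) = Transposition.transpose a b"
proof -
  let ?t = "Transposition.transpose s"
  have tS: "?t i permutes S" if "i \<in> S" for i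
    using s that by (simp add: permutes_swap_id)
  consider "S = {s}" | j where "S = {s, j}" "j \<noteq> s"
    | j k where "j \<in> S" "k \<in> S" "j \<noteq> s" "k \<noteq> s" "j \<noteq> k"
    using s by blast
  then show ?thesis
  proof cases
    case 1 then show ?thesis by blast
  next
    case 2
    obtain c d where "c \<in> S" "d \<in> S" "c \<noteq> d" "\<phi> (?t j) = Transposition.transpose c d"
      using transpose_image[OF assms(1) s, of j] 2 by auto
    then show ?thesis using 2 by (intro bexI[of _ c]) auto
  next
    case 3
    have nc: "?t i \<circ> ?t j \<noteq> ?t j \<circ> ?t i" if "i \<noteq> s" "j \<noteq> s" "i \<noteq> j" for i j
      using transpose_commute_iff[of s i s j] that by (auto simp: doubleton_eq_iff)
    have share: "\<exists>a b d. \<phi> (?t i) = Transposition.transpose a b \<and> \<phi> (?t j) = Transposition.transpose a d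
        \<and> a \<in> S \<and> b \<in> S \<and> d \<in> S \<and> a \<noteq> b \<and> a \<noteq> d \<and> b \<noteq> d"
      if ij: "i \<in> S" "j \<in> S" "i \<noteq> s" "j \<noteq> s" "i \<noteq> j" for i j
    proof -
      obtain a b where ab: "a \<in> S" "b \<in> S" "a \<noteq> b" "\<phi> (?t i) = Transposition.transpose a b"
        using transpose_image[OF assms(1) s ij(1)] ij by metis
      obtain c d where cd: "c \<in> S" "d \<in> S" "c \<noteq> d" "\<phi> (?t j) = Transposition.transpose c d"
        using transpose_image[OF assms(1) s ij(2)] ij by metis
      have "\<phi> (?t i \<circ> ?t j) \<noteq> \<phi> (?t j \<circ> ?t i)"
        using nc[of i j] ij tS eq_iff permutes_compose by metis
      then have "\<not> ({a, b} = {c, d} \<or> {a, b} \<inter> {c, d} = {})"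
        using transpose_commute_iff[OF ab(3) cd(3)] mult tS ij ab cd by metis
      then consider "a = c" "b \<noteq> d" | "a = d" "b \<noteq> c" | "b = c" "a \<noteq> d" | "b = d" "a \<noteq> c" by blast
      then show ?thesis
      proof cases
        case 1
        then show ?thesis using ab cd by blast
      next
        case 2
        then show ?thesis using ab cd transpose_commute[of c d] by metis
      next
        case 3
        then show ?thesis using ab cd transpose_commute[of a b] by metis
      next
        case 4
        then show ?thesis using ab cd transpose_commute[of a b] transpose_commute[of c d] by metis
      qed
    qed
    obtain a b d where abd: "\<phi> (?t j) = Transposition.transpose a b" "\<phi> (?t k) = Transposition.transpose a d"
        "a \<in> S" "b \<in> S" "d \<in> S" "a \<noteq> b" "a \<noteq> d" "b \<noteq> d"
      using share[OF 3] by blast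
    have "\<exists>b\<in>S - {a}. \<phi> (?t i) = Transposition.transpose a b" if i: "i \<in> S - {s}" for i
    proof (cases "i = j \<or> i = k")
      case True
      then show ?thesis using abd by auto
    next
      case False
      obtain a1 b1 d1 where 1: "\<phi> (?t i) = Transposition.transpose a1 b1"
        "\<phi> (?t j) = Transposition.transpose a1 d1" "a1 \<in> S" "b1 \<in> S" "a1 \<noteq> b1" "a1 \<noteq> d1"
        using share[of i j] i False 3 by blast
      obtain a2 b2 d2 where 2: "\<phi> (?t i) = Transposition.transpose a2 b2"
        "\<phi> (?t k) = Transposition.transpose a2 d2" "a2 \<noteq> b2" "a2 \<noteq> d2"
        using share[of i k] i False 3 by blast
      have e1: "{a1, d1} = {a, b}" using 1 abd(1) 
        by (metis transpose_eq_imp_eq_set)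
      have e2: "{a2, d2} = {a, d}" using 2 abd(2)
        by (metis transpose_eq_imp_eq_set)
      have e3: "{a1, b1} = {a2, b2}" using 1 2
        by (metis transpose_eq_imp_eq_set)
      show ?thesis
      proof (cases "a \<in> {a1, b1}")
        case True
        then consider "a = a1" | "a = b1" by blast
        then show ?thesis
        proof cases
          case 1
          then show ?thesis using \<open>\<phi> (?t i) = Transposition.transpose a1 b1\<close> \<open>a1 \<noteq> b1\<close> \<open>b1 \<in> S\<close> by blast
        next
          case 2
          then have "\<phi> (?t i) = Transposition.transpose a a1"
            using \<open>\<phi> (?t i) = Transposition.transpose a1 b1\<close> by (simp add: transpose_commute)
          then show ?thesis using 2 \<open>a1 \<noteq> b1\<close> \<open>a1 \<in> S\<close> by blast
        qed
      next
        case False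
        then have "a1 = b" "a2 = d" using e1 e2 e3 by (metis doubleton_eq_iff insertCI)+
        then have "b1 = d" using e3 abd(8) by (metis doubleton_eq_iff)
        then have i_bd: "\<phi> (?t i) = Transposition.transpose b d"
          using 1(1) \<open>a1 = b\<close> by simp
        \<comment> \<open>The remaining case, a triangle instead of a star, would make \<open>(s i)\<close> equal to
          \<open>(s j)(s k)(s j) = (j k)\<close>.\<close>
        have "\<phi> (?t j \<circ> ?t k \<circ> ?t j) = Transposition.transpose a b \<circ> Transposition.transpose a d \<circ> Transposition.transpose a b"
          using tS 3 abd by (simp add: mult permutes_compose)
        also have "\<dots> = Transposition.transpose b d"
          using transpose_conj[OF bij_transpose, of a b a d] abd by simp
        finally have "?t j \<circ> ?t k \<circ> ?t j = ?t i"
          using i_bd eq_iff[of "?t j \<circ> ?t k \<circ> ?t j" "?t i"] tS 3 i by (simp add: permutes_compose)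
        then have "?t j (?t k (?t j s)) = ?t i s" by (metis comp_apply)
        then show ?thesis using 3 i by simp
      qed
    qed
    then show ?thesis using abd(3) by blast
  qed
qed

text \<open>The transpositions \<open>(s i)\<close> with a fixed \<open>s\<close> generate the group, so it is enough to find a \<open>g\<close>
that conjugates each of them to its image.\<close>

lemma inner:
  assumes "card S \<noteq> 6"
  shows "\<exists>g. g permutes S \<and> (\<forall>p. p permutes S \<longrightarrow> \<phi> p = g \<circ> p \<circ> inv' g)"
proof (cases "S = {}")
  case True
  then show ?thesis using one by (intro exI[of _ id]) auto
next
  case False
  then obtain s where s: "s \<in> S" by blast
  let ?t = "Transposition.transpose s"
  have tS: "?t i permutes S" if "i \<in> S" for i
    using s that by (simp add: permutes_swap_id)
  obtain a b where a: "a \<in> S" and b: "\<And>i. i \<in> S - {s} \<Longrightarrow> b i \<in> S - {a}"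
      "\<And>i. i \<in> S - {s} \<Longrightarrow> \<phi> (?t i) = Transposition.transpose a (b i)"
    using ex_star_centre[OF assms s] by metis
  \<comment> \<open>The conjugating permutation sends the centre of one star to that of the other and follows
    the rays.\<close>
  define g where "g x = (if x \<in> S then if x = s then a else b x else x)" for x
  have gt: "\<phi> (?t i) = Transposition.transpose (g s) (g i)" if "i \<in> S" for i
    using b(2)[of i] that s one by (cases "i = s") (auto simp: g_def)
  have "i = j" if ij: "i \<in> S" "j \<in> S" "g i = g j" for i j
  proof -
    have "?t i = ?t j" using gt[OF ij(1)] gt[OF ij(2)] eq_iff[OF tS tS] ij by metis
    then show ?thesis by (metis transpose_apply_first)
  qed
  then have "inj_on g S" by (rule inj_onI)
  moreover have "g ` S \<subseteq> S" using a b(1) by (auto simp: g_def)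
  ultimately have "bij_betw g S S" using fin by (simp add: bij_betw_def endo_inj_surj)
  then have g: "g permutes S" by (rule bij_imp_permutes) (simp add: g_def)
  have conj_mult: "(g \<circ> p \<circ> inv' g) \<circ> (g \<circ> q \<circ> inv' g) = g \<circ> (p \<circ> q) \<circ> inv' g" for p q
    using permutes_inverses[OF g] by (simp add: fun_eq_iff)
  have tr: "\<phi> (Transposition.transpose x y) = g \<circ> Transposition.transpose x y \<circ> inv' g"
    if xy: "x \<in> S" "y \<in> S" "x \<noteq> y" for x y
  proof -
    have t: "\<phi> (?t i) = g \<circ> ?t i \<circ> inv' g" if "i \<in> S" for i
      unfolding gt[OF that] transpose_conj[OF permutes_bij[OF g]] ..
    consider "x = s" | "y = s" | "x \<noteq> s" "y \<noteq> s" by blast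
    then show ?thesis
    proof cases
      case 1 then show ?thesis using t xy by simp
    next
      case 2 then show ?thesis using t xy by (metis transpose_commute)
    next
      case 3
      have *: "Transposition.transpose x y = ?t x \<circ> ?t y \<circ> ?t x"
        using transpose_conj[OF bij_transpose, of s x s y] 3 xy by simp
      have "\<phi> (?t x \<circ> ?t y \<circ> ?t x) = \<phi> (?t x) \<circ> \<phi> (?t y) \<circ> \<phi> (?t x)"
        using tS xy by (simp add: mult permutes_compose)
      also have "\<dots> = g \<circ> (?t x \<circ> ?t y \<circ> ?t x) \<circ> inv' g"
        unfolding t[OF xy(1)] t[OF xy(2)] conj_mult ..
      finally show ?thesis unfolding * .
    qed
  qed
  have "\<phi> p = g \<circ> p \<circ> inv' g" if "p permutes S" for p
    using that fin
  proof (induction rule: permutes_induct)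
    case id
    show ?case unfolding one using permutes_inv_o(1)[OF g] by simp
  next
    case (swap x y p)
    have "\<phi> (Transposition.transpose x y \<circ> p) = \<phi> (Transposition.transpose x y) \<circ> \<phi> p"
      using swap by (intro mult permutes_swap_id)
    also have "\<dots> = g \<circ> (Transposition.transpose x y \<circ> p) \<circ> inv' g"
      unfolding swap.IH tr[OF swap.hyps(1-3)] conj_mult ..
    finally show ?case .
  qed
  with g show ?thesis by blast
qed

end

section \<open>Roots of unity and multisets\<close>

lemma card_set_mset_le_size: "card (set_mset M) \<le> size M"
  by (induction M) (auto simp: card_insert_if)

lemma (in field) card_roots_of_unity_le:
  assumes "d > 0"
  shows "finite {x \<in> carrier R. x [^] d = \<one>} \<and> card {x \<in> carrier R. x [^] d = \<one>} \<le> d"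
proof -
  \<comment> \<open>The polynomial \<open>X\<^sup>d - 1\<close> as a list of coefficients, leading coefficient first.\<close>
  define p where "p = (\<one> # replicate (d - 1) \<zero>) @ [\<ominus> \<one>]"
  have p: "p \<in> carrier (poly_ring R)"
    unfolding p_def univ_poly_carrier[symmetric] polynomial_def by auto
  have m: "monom \<one> (d - 1) = \<one> # replicate (d - 1) \<zero>"
    by (simp add: monom_def)
  have set0: "set (\<one> # replicate (d - 1) \<zero>) \<subseteq> carrier R" by auto
  have "is_root p x" if "x \<in> carrier R" "x [^] d = \<one>" for x
  proof -
    have "eval p x = (\<one> \<otimes> x [^] (d - 1)) \<otimes> x \<oplus> \<ominus> \<one>"
      unfolding p_def using eval_append_aux[of "\<one> # replicate (d - 1) \<zero>" "\<ominus> \<one>" x] that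
        eval_monom[of "\<one>" x "d - 1"] set0 unfolding m by simp
    also have "\<dots> = x [^] d \<oplus> \<ominus> \<one>"
      using that assms by (cases d) auto
    finally show ?thesis using that unfolding is_root_def by (simp add: p_def r_neg)
  qed
  then have sub: "{x \<in> carrier R. x [^] d = \<one>} \<subseteq> set_mset (roots p)"
    using roots_mem_iff_is_root[OF p] by auto
  have "size (roots p) \<le> d"
    using size_roots_le_degree[OF p] assms unfolding p_def by simp
  moreover have "card (set_mset (roots p)) \<le> size (roots p)"
    by (rule card_set_mset_le_size)
  ultimately have "card {x \<in> carrier R. x [^] d = \<one>} \<le> d"
    using card_mono[OF finite_set_mset sub] by linarith
  then show ?thesis using sub finite_subset by blast
qed

text \<open>The powers of a primitive root are \<open>d\<close> different roots of \<open>X\<^sup>d - 1\<close>, which has no more than \<open>d\<close>.\<close>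

lemma (in field) card_roots_of_unity:
  assumes z: "primitive_root R d z" and d: "d > 0"
  shows "card {x \<in> carrier (Multiplicative_Group.mult_of R). x [^]\<^bsub>Multiplicative_Group.mult_of R\<^esub> d = \<one>\<^bsub>Multiplicative_Group.mult_of R\<^esub>} = d"
proof -
  let ?A = "{x \<in> carrier R. x [^] d = \<one>}"
  have zc: "z \<in> carrier R" and zd: "z [^] d = \<one>"
    and zk: "\<And>k. 0 < k \<Longrightarrow> k < d \<Longrightarrow> z [^] k \<noteq> \<one>"
    using z by (auto simp: primitive_root_def)
  have z0: "z \<noteq> \<zero>" using zd d nat_pow_zero[of d] by auto
  have le: False if "k < l" "l < d" "z [^] k = z [^] l" for k l
  proof -
    have "z [^] k \<otimes> z [^] (l - k) = z [^] (k + (l - k))" by (rule nat_pow_mult[OF zc])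
    also have "k + (l - k) = l" using that(1) by simp
    also have "z [^] l = z [^] k \<otimes> \<one>" using that(3) zc by simp
    finally have "z [^] k \<otimes> z [^] (l - k) = z [^] k \<otimes> \<one>" .
    moreover have "z [^] k \<noteq> \<zero>" using Units_pow_closed[of z k] zc z0 field_Units by blast
    ultimately have "z [^] (l - k) = \<one>" using zc by (metis m_lcancel nat_pow_closed one_closed)
    then show False using zk[of "l - k"] that by simp
  qed
  have "inj_on (\<lambda>k. z [^] k) {..<d}"
  proof (rule inj_onI)
    fix k l assume "k \<in> {..<d}" "l \<in> {..<d}" "z [^] k = z [^] l"
    then show "k = l" using le[of k l] le[of l k] by (metis lessThan_iff linorder_neqE_nat)
  qed
  then have card_pows: "card ((\<lambda>k. z [^] k) ` {..<d}) = d" by (simp only: card_image card_lessThan)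
  have pows: "(\<lambda>k. z [^] k) ` {..<d} \<subseteq> ?A"
  proof (rule image_subsetI)
    fix k
    have "(z [^] k) [^] d = z [^] (k * d)" by (rule nat_pow_pow[OF zc])
    also have "k * d = d * k" by (rule mult.commute)
    also have "z [^] (d * k) = (z [^] d) [^] k" by (rule nat_pow_pow[OF zc, symmetric])
    also have "\<dots> = \<one>" unfolding zd by (rule nat_pow_one)
    finally have "(z [^] k) [^] d = \<one>" .
    then show "z [^] k \<in> ?A" using nat_pow_closed[OF zc] by blast
  qed
  have "d \<le> card ?A"
    using card_mono[OF conjunct1[OF card_roots_of_unity_le[OF d]] pows] unfolding card_pows .
  then have "card ?A = d" using conjunct2[OF card_roots_of_unity_le[OF d]] by (rule le_antisym[rotated])
  moreover have "\<zero> \<notin> ?A" using nat_pow_zero[of d] d by auto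
  then have "{x \<in> carrier (Multiplicative_Group.mult_of R).
      x [^]\<^bsub>Multiplicative_Group.mult_of R\<^esub> d = \<one>\<^bsub>Multiplicative_Group.mult_of R\<^esub>} = ?A"
    unfolding Multiplicative_Group.nat_pow_mult_of Multiplicative_Group.one_mult_of
      Multiplicative_Group.carrier_mult_of by blast
  ultimately show ?thesis by (simp only:)
qed

text \<open>Isomorphism will be described by equality of an invariant; the number of isomorphism classes is
then the number of values of the invariant.\<close>

lemma card_quotient_kernel:
  "card (A // {(x, y) \<in> A \<times> A. f x = f y}) = card (f ` A)"
proof -
  have "A // {(x, y) \<in> A \<times> A. f x = f y} = (\<lambda>v. {x \<in> A. v = f x}) ` f ` A"
    unfolding quotient_def by auto
  moreover have "inj_on (\<lambda>v. {x \<in> A. v = f x}) (f ` A)"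
    by (rule inj_onI) blast
  ultimately show ?thesis by (simp add: card_image)
qed

text \<open>Every multiset of size \<open>r\<^sub>C\<close> is the multiset of members of some family indexed by \<open>I\<^sub>C\<close>.\<close>

lemma ex_image_mset_mset_set:
  assumes "finite A" "card A = size M"
  shows "\<exists>f. image_mset f (mset_set A) = M"
  using assms
proof (induction M arbitrary: A)
  case empty
  then show ?case by auto
next
  case (add x M)
  then obtain a B where A: "A = insert a B" "a \<notin> B" "finite B"
    by (metis card_Suc_eq finite_insert size_add_mset)
  then obtain f where "image_mset f (mset_set B) = M" using add by fastforce
  moreover have "image_mset (f(a := x)) (mset_set B) = image_mset f (mset_set B)"
    using A by (intro image_mset_cong) auto
  ultimately show ?case using A by (intro exI[of _ "f(a := x)"]) (simp del: fun_upd_apply add: fun_upd_same)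
qed

section \<open>Transport of characters along conjugation\<close>

context group
begin

lemma inv_mult_cancel [simp]:
  "x \<in> carrier G \<Longrightarrow> y \<in> carrier G \<Longrightarrow> inv x \<otimes> (x \<otimes> y) = y"
  "x \<in> carrier G \<Longrightarrow> y \<in> carrier G \<Longrightarrow> x \<otimes> (inv x \<otimes> y) = y"
  by (simp_all flip: m_assoc)

lemma conj_inj:
  "g \<in> carrier G \<Longrightarrow> x \<in> carrier G \<Longrightarrow> y \<in> carrier G \<Longrightarrow> g \<otimes> x \<otimes> inv g = g \<otimes> y \<otimes> inv g \<longleftrightarrow> x = y"
  by simp

lemma conj_conj:
  "g \<in> carrier G \<Longrightarrow> h \<in> carrier G \<Longrightarrow> x \<in> carrier G \<Longrightarrow>
     h \<otimes> (g \<otimes> x \<otimes> inv g) \<otimes> inv h = (h \<otimes> g) \<otimes> x \<otimes> inv (h \<otimes> g)"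
  by (simp add: m_assoc inv_mult_group)

lemma subgroup_centralizer:
  assumes "u \<in> carrier G" shows "subgroup (centralizer G u) G"
proof (rule subgroupI)
  show "centralizer G u \<subseteq> carrier G" by (auto simp: centralizer_def)
  have "\<one> \<in> centralizer G u" using assms by (simp add: centralizer_def)
  then show "centralizer G u \<noteq> {}" by blast
  fix a assume a: "a \<in> centralizer G u"
  then have aG: "a \<in> carrier G" and au: "a \<otimes> u = u \<otimes> a" by (auto simp: centralizer_def)
  have "inv a \<otimes> u = inv a \<otimes> (u \<otimes> a) \<otimes> inv a" using aG assms by (simp add: m_assoc)
  also have "\<dots> = u \<otimes> inv a" unfolding au[symmetric] using aG assms by simp
  finally show "inv a \<in> centralizer G u" using aG by (simp add: centralizer_def)
  fix b assume b: "b \<in> centralizer G u"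
  then have bG: "b \<in> carrier G" and bu: "b \<otimes> u = u \<otimes> b" by (auto simp: centralizer_def)
  have "a \<otimes> b \<otimes> u = a \<otimes> u \<otimes> b" using aG bG bu assms by (simp add: m_assoc)
  also have "\<dots> = u \<otimes> (a \<otimes> b)" unfolding au using aG bG assms by (simp add: m_assoc)
  finally show "a \<otimes> b \<in> centralizer G u" using aG bG by (simp add: centralizer_def)
qed

lemma centralizer_iff:
  assumes "u \<in> carrier G"
  shows "x \<in> centralizer G u \<longleftrightarrow> x \<in> carrier G \<and> x \<otimes> u \<otimes> inv x = u"
proof (cases "x \<in> carrier G")
  case True
  then have "u = x \<otimes> u \<otimes> inv x \<longleftrightarrow> x \<otimes> u = u \<otimes> x"
    using assms by (intro inv_solve_right) simp_all
  then show ?thesis using True by (auto simp: centralizer_def)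
qed (simp add: centralizer_def)

lemma conj_in_centralizer_iff:
  assumes "u \<in> carrier G" "g \<in> carrier G" "x \<in> carrier G"
  shows "g \<otimes> x \<otimes> inv g \<in> centralizer G (g \<otimes> u \<otimes> inv g) \<longleftrightarrow> x \<in> centralizer G u"
proof -
  have "(g \<otimes> x \<otimes> inv g) \<otimes> (g \<otimes> u \<otimes> inv g) = g \<otimes> (x \<otimes> u) \<otimes> inv g"
    "(g \<otimes> u \<otimes> inv g) \<otimes> (g \<otimes> x \<otimes> inv g) = g \<otimes> (u \<otimes> x) \<otimes> inv g"
    using assms by (simp_all add: m_assoc)
  then show ?thesis
    using assms conj_inj[of g "x \<otimes> u" "u \<otimes> x"] by (simp add: centralizer_def)
qed

lemma centralizer_conj:
  assumes "u \<in> carrier G" "g \<in> carrier G"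
  shows "y \<in> centralizer G (g \<otimes> u \<otimes> inv g) \<longleftrightarrow> y \<in> carrier G \<and> inv g \<otimes> y \<otimes> g \<in> centralizer G u"
proof (cases "y \<in> carrier G")
  case True
  then have "g \<otimes> (inv g \<otimes> y \<otimes> g) \<otimes> inv g = y" using assms by (simp add: m_assoc)
  then show ?thesis using conj_in_centralizer_iff[of u g "inv g \<otimes> y \<otimes> g"] assms True by simp
qed (simp add: centralizer_def)

lemma conj_classesE:
  assumes "C \<in> conj_classes G"
  obtains x where "x \<in> carrier G" "C = conj_class G x" "x \<in> C"
proof -
  obtain x where x: "x \<in> carrier G" "C = conj_class G x" using assms by (auto simp: conj_classes_def)
  have "x = \<one> \<otimes> x \<otimes> inv \<one>" using x by simp
  then have "x \<in> C" unfolding x(2) conj_class_def by blast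
  then show ?thesis using that x by blast
qed

lemma conj_class_closed:
  assumes "C \<in> conj_classes G" "x \<in> C"
  shows "x \<in> carrier G" "g \<in> carrier G \<Longrightarrow> g \<otimes> x \<otimes> inv g \<in> C"
proof -
  obtain y where y: "y \<in> carrier G" "C = conj_class G y" using assms(1) by (rule conj_classesE)
  then obtain h where h: "h \<in> carrier G" "x = h \<otimes> y \<otimes> inv h" using assms(2) by (auto simp: conj_class_def)
  then show "x \<in> carrier G" using y by simp
  assume g: "g \<in> carrier G"
  have "g \<otimes> x \<otimes> inv g = (g \<otimes> h) \<otimes> y \<otimes> inv (g \<otimes> h)"
    unfolding h(2) using g h y by (simp only: conj_conj)
  then show "g \<otimes> x \<otimes> inv g \<in> C" unfolding y(2) conj_class_def using g h by blast
qed

lemma conj_class_transitive: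
  assumes "C \<in> conj_classes G" "x \<in> C" "y \<in> C"
  shows "\<exists>g\<in>carrier G. g \<otimes> x \<otimes> inv g = y"
proof -
  obtain z where z: "z \<in> carrier G" "C = conj_class G z" using assms(1) by (rule conj_classesE)
  obtain h where h: "h \<in> carrier G" "x = h \<otimes> z \<otimes> inv h" using assms z by (auto simp: conj_class_def)
  obtain k where k: "k \<in> carrier G" "y = k \<otimes> z \<otimes> inv k" using assms z by (auto simp: conj_class_def)
  have "(k \<otimes> inv h) \<otimes> x \<otimes> inv (k \<otimes> inv h) = y"
    unfolding h(2) k(2) using h k z by (simp add: m_assoc inv_mult_group)
  then show ?thesis using h k by (intro bexI[of _ "k \<otimes> inv h"]) simp_all
qed

lemma finite_conj_classes: "finite (carrier G) \<Longrightarrow> finite (conj_classes G)"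
  by (simp add: conj_classes_def)

lemma conj_image_class:
  assumes C: "C \<in> conj_classes G" and k: "k \<in> carrier G"
  shows "(\<lambda>x. k \<otimes> x \<otimes> inv k) ` C = C"
proof
  show "(\<lambda>x. k \<otimes> x \<otimes> inv k) ` C \<subseteq> C" using conj_class_closed[OF C] k by blast
  show "C \<subseteq> (\<lambda>x. k \<otimes> x \<otimes> inv k) ` C"
  proof
    fix x assume x: "x \<in> C"
    have "x = k \<otimes> (inv k \<otimes> x \<otimes> inv (inv k)) \<otimes> inv k"
      using conj_class_closed(1)[OF C x] k by (simp add: m_assoc)
    then show "x \<in> (\<lambda>x. k \<otimes> x \<otimes> inv k) ` C"
      using conj_class_closed(2)[OF C x, of "inv k"] k by blast
  qed
qed

end

locale group_field = group G + F: field F for G :: "'g monoid" (structure) and F :: "('f, 'c) ring_scheme"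
begin

text \<open>The transport of a character \<open>\<chi>\<close> of the centralizer of \<open>u\<close> along conjugation by \<open>g\<close>. It is
restricted because characters are extensional.\<close>

definition conj_char :: "'g \<Rightarrow> 'g \<Rightarrow> ('g \<Rightarrow> 'f) \<Rightarrow> 'g \<Rightarrow> 'f" where
  "conj_char u g \<chi> = restrict (\<lambda>y. \<chi> (inv g \<otimes> y \<otimes> g)) (centralizer G (g \<otimes> u \<otimes> inv g))"

lemma charactersD:
  assumes "\<chi> \<in> characters F G (centralizer G u)"
  shows "x \<in> centralizer G u \<Longrightarrow> \<chi> x \<in> carrier F - {\<zero>\<^bsub>F\<^esub>}"
    and "x \<in> centralizer G u \<Longrightarrow> y \<in> centralizer G u \<Longrightarrow> \<chi> (x \<otimes> y) = \<chi> x \<otimes>\<^bsub>F\<^esub> \<chi> y"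
    and "\<chi> \<in> extensional (centralizer G u)"
  using assms by (auto simp: characters_def hom_def)

lemma conj_char_in_characters:
  assumes \<chi>: "\<chi> \<in> characters F G (centralizer G u)" and u: "u \<in> carrier G" and g: "g \<in> carrier G"
  shows "conj_char u g \<chi> \<in> characters F G (centralizer G (g \<otimes> u \<otimes> inv g))"
proof -
  let ?Z = "centralizer G (g \<otimes> u \<otimes> inv g)"
  have Z: "inv g \<otimes> y \<otimes> g \<in> centralizer G u" "y \<in> carrier G" if "y \<in> ?Z" for y
    using that centralizer_conj[OF u g] by auto
  have "subgroup ?Z G" using u g by (intro subgroup_centralizer) simp
  then have cl: "x \<otimes> y \<in> ?Z" if "x \<in> ?Z" "y \<in> ?Z" for x y
    using that by (rule subgroup.m_closed)
  have "\<chi> (inv g \<otimes> (x \<otimes> y) \<otimes> g) = \<chi> (inv g \<otimes> x \<otimes> g) \<otimes>\<^bsub>F\<^esub> \<chi> (inv g \<otimes> y \<otimes> g)"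
    if "x \<in> ?Z" "y \<in> ?Z" for x y
  proof -
    have "inv g \<otimes> (x \<otimes> y) \<otimes> g = (inv g \<otimes> x \<otimes> g) \<otimes> (inv g \<otimes> y \<otimes> g)"
      using Z(2) that g by (simp add: m_assoc)
    then show ?thesis using charactersD(2)[OF \<chi> Z(1) Z(1)] that by simp
  qed
  then show ?thesis
    using charactersD(1)[OF \<chi> Z(1)] cl by (auto simp: characters_def hom_def conj_char_def)
qed

lemma conj_char_comp:
  assumes u: "u \<in> carrier G" and g: "g \<in> carrier G" and h: "h \<in> carrier G"
  shows "conj_char (g \<otimes> u \<otimes> inv g) h (conj_char u g \<chi>) = conj_char u (h \<otimes> g) \<chi>"
proof
  fix y
  have c: "(h \<otimes> g) \<otimes> u \<otimes> inv (h \<otimes> g) = h \<otimes> (g \<otimes> u \<otimes> inv g) \<otimes> inv h"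
    using assms by (simp only: conj_conj)
  show "conj_char (g \<otimes> u \<otimes> inv g) h (conj_char u g \<chi>) y = conj_char u (h \<otimes> g) \<chi> y"
  proof (cases "y \<in> centralizer G (h \<otimes> (g \<otimes> u \<otimes> inv g) \<otimes> inv h)")
    case True
    then have "inv h \<otimes> y \<otimes> h \<in> centralizer G (g \<otimes> u \<otimes> inv g)" "y \<in> carrier G"
      using centralizer_conj[of "g \<otimes> u \<otimes> inv g" h] assms by auto
    then show ?thesis
      using True assms unfolding conj_char_def c by (simp add: m_assoc inv_mult_group)
  next
    case False
    then show ?thesis unfolding conj_char_def c by simp
  qed
qed

text \<open>Characters are class functions: on their own group, inner automorphisms do not change them.\<close>

lemma conj_char_centralizer:
  assumes \<chi>: "\<chi> \<in> characters F G (centralizer G u)" and u: "u \<in> carrier G" and g: "g \<in> centralizer G u"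
  shows "conj_char u g \<chi> = \<chi>"
proof
  fix y
  have gG: "g \<in> carrier G" "g \<otimes> u \<otimes> inv g = u" using g u centralizer_iff by auto
  interpret Z: subgroup "centralizer G u" G by (rule subgroup_centralizer[OF u])
  show "conj_char u g \<chi> y = \<chi> y"
  proof (cases "y \<in> centralizer G u")
    case True
    have yG: "y \<in> carrier G" using True Z.subset by blast
    have z: "inv g \<otimes> y \<otimes> g \<in> centralizer G u" using True g by simp
    \<comment> \<open>Both sides of \<open>g (g\<^sup>-\<^sup>1 y g) = y g\<close> lie in the centralizer; the values of \<open>\<chi>\<close> commute.\<close>
    have "\<chi> g \<otimes>\<^bsub>F\<^esub> \<chi> (inv g \<otimes> y \<otimes> g) = \<chi> (y \<otimes> g)"
      using charactersD(2)[OF \<chi> g z] gG(1) yG by (simp add: m_assoc)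
    also have "\<dots> = \<chi> g \<otimes>\<^bsub>F\<^esub> \<chi> y"
      using charactersD(2)[OF \<chi> True g] charactersD(1)[OF \<chi> True] charactersD(1)[OF \<chi> g]
      by (simp add: F.m_comm)
    finally have "\<chi> (inv g \<otimes> y \<otimes> g) = \<chi> y"
      using charactersD(1)[OF \<chi> True] charactersD(1)[OF \<chi> g] charactersD(1)[OF \<chi> z]
        F.m_lcancel[of "\<chi> g" "\<chi> (inv g \<otimes> y \<otimes> g)" "\<chi> y"] by simp
    then show ?thesis unfolding conj_char_def gG(2) using True by simp
  next
    case False
    then show ?thesis
      unfolding conj_char_def gG(2) using charactersD(3)[OF \<chi>] by (simp add: extensional_def)
  qed
qed

text \<open>Hence the transported character depends only on where \<open>u\<close> is moved to, and characters at
different elements of a conjugacy class can be compared without ambiguity.\<close>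

lemma conj_char_cong:
  assumes \<chi>: "\<chi> \<in> characters F G (centralizer G u)" and u: "u \<in> carrier G"
    and g: "g \<in> carrier G" and h: "h \<in> carrier G" and eq: "g \<otimes> u \<otimes> inv g = h \<otimes> u \<otimes> inv h"
  shows "conj_char u g \<chi> = conj_char u h \<chi>"
proof -
  \<comment> \<open>The two conjugations differ by the element \<open>h\<^sup>-\<^sup>1 g\<close> of the centralizer.\<close>
  let ?k = "inv h \<otimes> g"
  have "?k \<otimes> u \<otimes> inv ?k = inv h \<otimes> (g \<otimes> u \<otimes> inv g) \<otimes> inv (inv h)"
    using u g h by (simp only: conj_conj inv_closed)
  also have "\<dots> = u" unfolding eq using u h by (simp add: m_assoc)
  finally have ku: "?k \<otimes> u \<otimes> inv ?k = u" .
  then have k: "?k \<in> centralizer G u" using u g h by (simp add: centralizer_iff)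
  have "conj_char u g \<chi> = conj_char u (h \<otimes> ?k) \<chi>"
    using g h by simp
  also have "\<dots> = conj_char (?k \<otimes> u \<otimes> inv ?k) h (conj_char u ?k \<chi>)"
    using u g h by (simp only: conj_char_comp m_closed inv_closed)
  also have "\<dots> = conj_char u h \<chi>"
    unfolding ku conj_char_centralizer[OF \<chi> u k] ..
  finally show ?thesis .
qed

lemma card_characters_conj:
  assumes u: "u \<in> carrier G" and g: "g \<in> carrier G"
  shows "card (characters F G (centralizer G (g \<otimes> u \<otimes> inv g))) = card (characters F G (centralizer G u))"
proof -
  let ?v = "g \<otimes> u \<otimes> inv g"
  have v: "?v \<in> carrier G" "inv g \<otimes> ?v \<otimes> inv (inv g) = u" using u g by (simp_all add: m_assoc)
  have id: "conj_char w \<one> \<chi> = \<chi>" if "\<chi> \<in> characters F G (centralizer G w)" "w \<in> carrier G" for w \<chi>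
    using that by (intro conj_char_centralizer) (auto simp: centralizer_def)
  have "bij_betw (conj_char u g) (characters F G (centralizer G u)) (characters F G (centralizer G ?v))"
  proof (rule bij_betw_byWitness[where f' = "conj_char ?v (inv g)"])
    show "\<forall>\<chi>\<in>characters F G (centralizer G u). conj_char ?v (inv g) (conj_char u g \<chi>) = \<chi>"
      unfolding conj_char_comp[OF u g inv_closed[OF g]] l_inv[OF g] using id[OF _ u] by blast
    show "\<forall>\<chi>\<in>characters F G (centralizer G ?v). conj_char u g (conj_char ?v (inv g) \<chi>) = \<chi>"
      using conj_char_comp[OF v(1) inv_closed[OF g] g] id[OF _ v(1)] unfolding v(2) r_inv[OF g] by simp
    show "conj_char u g ` characters F G (centralizer G u) \<subseteq> characters F G (centralizer G ?v)"
      using conj_char_in_characters[OF _ u g] by (rule image_subsetI)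
    show "conj_char ?v (inv g) ` characters F G (centralizer G ?v) \<subseteq> characters F G (centralizer G u)"
      using conj_char_in_characters[OF _ v(1) inv_closed[OF g]] unfolding v(2) by (rule image_subsetI)
  qed
  then show ?thesis by (simp add: bij_betw_same_card)
qed

text \<open>By Lagrange, all values are roots of \<open>X\<^sup>m - 1\<close>, where \<open>m\<close> is the order of the group.\<close>

lemma finite_characters:
  assumes fin: "finite (carrier G)" and u: "u \<in> carrier G"
  shows "finite (characters F G (centralizer G u))"
proof -
  let ?Z = "centralizer G u"
  let ?R = "{x \<in> carrier F. x [^]\<^bsub>F\<^esub> order G = \<one>\<^bsub>F\<^esub>}"
  interpret Z: subgroup ?Z G by (rule subgroup_centralizer[OF u])
  have ord: "order G > 0" using fin by (simp add: order_gt_0_iff_finite)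
  have "\<chi> x \<in> ?R" if \<chi>: "\<chi> \<in> characters F G ?Z" and x: "x \<in> ?Z" for \<chi> x
  proof -
    have c: "\<chi> x \<in> carrier F" using charactersD(1)[OF \<chi> x] by simp
    have "\<chi> \<one> \<otimes>\<^bsub>F\<^esub> \<chi> \<one> = \<chi> \<one>" using charactersD(2)[OF \<chi> Z.one_closed Z.one_closed] by simp
    then have one: "\<chi> \<one> = \<one>\<^bsub>F\<^esub>"
      using charactersD(1)[OF \<chi> Z.one_closed] F.m_lcancel[of "\<chi> \<one>" "\<chi> \<one>" "\<one>\<^bsub>F\<^esub>"] by auto
    have xG: "x \<in> carrier G" using x Z.subset by blast
    have "x [^] k \<in> ?Z \<and> \<chi> (x [^] k) = \<chi> x [^]\<^bsub>F\<^esub> k" for k :: nat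
      by (induction k) (use x xG one charactersD(2)[OF \<chi>] in auto)
    from this[of "order G"] show ?thesis
      using pow_order_eq_1[OF xG] one c by simp
  qed
  then have "characters F G ?Z \<subseteq> (?Z \<rightarrow>\<^sub>E ?R)"
    using charactersD(3) by (auto simp: PiE_def)
  moreover have "finite (?Z \<rightarrow>\<^sub>E ?R)"
    using F.card_roots_of_unity_le[OF ord] finite_subset[OF Z.subset fin]
    by (intro finite_PiE) auto
  ultimately show ?thesis by (rule finite_subset)
qed

end

section \<open>Classification of ramification systems\<close>

context group_field
begin

text \<open>The same choice as in the definition of \<open>gamma\<close>.\<close>

definition class_rep :: "'g set \<Rightarrow> 'g" where
  "class_rep C = (SOME \<sigma>. \<sigma> \<in> C)"

definition to_rep :: "'g set \<Rightarrow> 'g \<Rightarrow> 'g" where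
  "to_rep C u = (SOME g. g \<in> carrier G \<and> g \<otimes> u \<otimes> inv g = class_rep C)"

text \<open>The invariant that classifies ramification systems: for each ramified class, the characters are
transported to the centralizer of the representative, and their indices are forgotten.\<close>

definition class_multisets ::
  "('g set \<Rightarrow> nat) \<Rightarrow> ('g set \<Rightarrow> 'i set) \<Rightarrow> ('g, 'i, 'f) quadruple \<Rightarrow> 'g set \<Rightarrow> ('g \<Rightarrow> 'f) multiset" where
  "class_multisets r I = (\<lambda>(_, _, \<chi>, u). \<lambda>C\<in>ramified_classes G r.
     image_mset (\<lambda>i. conj_char (u C) (to_rep C (u C)) (\<chi> C i)) (mset_set (I C)))"

lemma class_rep_in: "C \<in> conj_classes G \<Longrightarrow> class_rep C \<in> C"
  unfolding class_rep_def by (rule someI_ex) (metis conj_classesE)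

lemma to_rep:
  assumes "C \<in> conj_classes G" "u \<in> C"
  shows "to_rep C u \<in> carrier G" "to_rep C u \<otimes> u \<otimes> inv (to_rep C u) = class_rep C"
proof -
  have "\<exists>g. g \<in> carrier G \<and> g \<otimes> u \<otimes> inv g = class_rep C"
    using conj_class_transitive[OF assms class_rep_in[OF assms(1)]] by blast
  from someI_ex[OF this] show "to_rep C u \<in> carrier G" "to_rep C u \<otimes> u \<otimes> inv (to_rep C u) = class_rep C"
    unfolding to_rep_def by auto
qed

end

text \<open>Where all automorphisms are inner, they map every conjugacy class to itself, and the classes can be
treated independently of each other.\<close>

locale inner_group_field = group_field G F
  for G :: "'g monoid" (structure) and F :: "('f, 'c) ring_scheme" +
  fixes r :: "'g set \<Rightarrow> nat" and I :: "'g set \<Rightarrow> 'i set"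
  assumes fin: "finite (carrier G)"
    and inner: "\<And>\<phi>. \<phi> \<in> iso G G \<Longrightarrow> \<exists>k\<in>carrier G. \<forall>x\<in>carrier G. \<phi> x = k \<otimes> x \<otimes> inv k"
    and r: "r \<in> ramifications G" and I: "index_sets G r I"
begin

lemma ramified: "C \<in> ramified_classes G r \<Longrightarrow> C \<in> conj_classes G"
  by (simp add: ramified_classes_def)

lemma finite_index: "C \<in> conj_classes G \<Longrightarrow> finite (I C)"
  and card_index: "C \<in> conj_classes G \<Longrightarrow> card (I C) = r C"
  using I by (auto simp: index_sets_def)

lemma RSC_u:
  assumes "is_RSC F I (G, r, \<chi>, u)" "C \<in> conj_classes G"
  shows "u C \<in> C" "u C \<in> carrier G"
proof -
  show "u C \<in> C" using assms by (auto simp: PiE_def Pi_def)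
  then show "u C \<in> carrier G" using conj_class_closed(1)[OF assms(2)] by blast
qed

lemma RSC_\<chi>:
  assumes "is_RSC F I (G, r, \<chi>, u)" "C \<in> ramified_classes G r" "i \<in> I C"
  shows "\<chi> C i \<in> characters F G (centralizer G (u C))"
  using assms by (auto simp: PiE_def Pi_def)

lemma isomorphic_imp_class_multisets_eq:
  assumes R: "is_RSC F I (G, r, \<chi>, u)" and R': "is_RSC F I (G, r, \<chi>', u')"
    and iso: "RSC_isomorphic I I (G, r, \<chi>, u) (G, r, \<chi>', u')"
  shows "class_multisets r I (G, r, \<chi>, u) = class_multisets r I (G, r, \<chi>', u')"
proof -
  obtain \<phi> h where \<phi>: "\<phi> \<in> iso G G" and h: "h \<in> conj_classes G \<rightarrow> carrier G"
    and hu: "\<And>C. C \<in> conj_classes G \<Longrightarrow> \<phi> (h C \<otimes> u C \<otimes> inv (h C)) = u' (\<phi> ` C)"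
    and h\<chi>: "\<And>C. C \<in> ramified_classes G r \<Longrightarrow> \<exists>\<psi>. bij_betw \<psi> (I C) (I (\<phi> ` C)) \<and>
           (\<forall>i \<in> I C. \<forall>x \<in> centralizer G (u C).
              \<chi>' (\<phi> ` C) (\<psi> i) (\<phi> (h C \<otimes> x \<otimes> inv (h C))) = \<chi> C i x)"
    using iso by auto
  obtain k where k: "k \<in> carrier G" "\<And>x. x \<in> carrier G \<Longrightarrow> \<phi> x = k \<otimes> x \<otimes> inv k"
    using inner[OF \<phi>] by blast
  have \<phi>C: "\<phi> ` C = C" if C: "C \<in> conj_classes G" for C
  proof -
    have "\<phi> ` C = (\<lambda>x. k \<otimes> x \<otimes> inv k) ` C"
      using k(2) conj_class_closed(1)[OF C] by (intro image_cong) auto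
    then show ?thesis using conj_image_class[OF C k(1)] by simp
  qed
  have "image_mset (\<lambda>i. conj_char (u C) (to_rep C (u C)) (\<chi> C i)) (mset_set (I C)) =
        image_mset (\<lambda>i. conj_char (u' C) (to_rep C (u' C)) (\<chi>' C i)) (mset_set (I C))"
    if C: "C \<in> ramified_classes G r" for C
  proof -
    note C' = ramified[OF C]
    note u = RSC_u[OF R C'] and u' = RSC_u[OF R' C']
    let ?g = "to_rep C (u C)" and ?g' = "to_rep C (u' C)"
    note g = to_rep[OF C' u(1)] and g' = to_rep[OF C' u'(1)]
    \<comment> \<open>As \<open>\<phi>\<close> is conjugation by \<open>k\<close>, the pair \<open>(\<phi>, h C)\<close> acts on this class as conjugation by \<open>k (h C)\<close>.\<close>
    define l where "l = k \<otimes> h C"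
    have hC: "h C \<in> carrier G" using h C' by blast
    then have l: "l \<in> carrier G" using k by (simp add: l_def)
    have \<phi>l: "\<phi> (h C \<otimes> x \<otimes> inv (h C)) = l \<otimes> x \<otimes> inv l" if "x \<in> carrier G" for x
      using that k hC by (simp add: l_def conj_conj)
    have lu: "l \<otimes> u C \<otimes> inv l = u' C" using hu[OF C'] \<phi>l[OF u(2)] \<phi>C[OF C'] by simp
    obtain \<psi> where \<psi>: "bij_betw \<psi> (I C) (I C)"
      "\<And>i x. i \<in> I C \<Longrightarrow> x \<in> centralizer G (u C) \<Longrightarrow> \<chi>' C (\<psi> i) (\<phi> (h C \<otimes> x \<otimes> inv (h C))) = \<chi> C i x"
      using h\<chi>[OF C] unfolding \<phi>C[OF C'] by blast
    have eq: "\<chi>' C (\<psi> i) = conj_char (u C) l (\<chi> C i)" if i: "i \<in> I C" for i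
    proof
      fix y
      have \<psi>i: "\<psi> i \<in> I C" using \<psi>(1) i by (auto simp: bij_betw_def)
      show "\<chi>' C (\<psi> i) y = conj_char (u C) l (\<chi> C i) y"
      proof (cases "y \<in> centralizer G (u' C)")
        case True
        then have z: "inv l \<otimes> y \<otimes> l \<in> centralizer G (u C)" and y: "y \<in> carrier G"
          using centralizer_conj[OF u(2) l] unfolding lu by auto
        have zG: "inv l \<otimes> y \<otimes> l \<in> carrier G" using y l by simp
        have "l \<otimes> (inv l \<otimes> y \<otimes> l) \<otimes> inv l = y" using y l by (simp add: m_assoc)
        then have "\<chi>' C (\<psi> i) y = \<chi> C i (inv l \<otimes> y \<otimes> l)"
          using \<psi>(2)[OF i z] \<phi>l[OF zG] by simp
        then show ?thesis using True unfolding conj_char_def lu by simp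
      next
        case False
        then show ?thesis
          using charactersD(3)[OF RSC_\<chi>[OF R' C \<psi>i]] unfolding conj_char_def lu
          by (simp add: extensional_def)
      qed
    qed
    have "image_mset (\<lambda>i. conj_char (u' C) ?g' (\<chi>' C i)) (mset_set (I C)) =
          image_mset (\<lambda>i. conj_char (u' C) ?g' (\<chi>' C i)) (image_mset \<psi> (mset_set (I C)))"
      using \<psi>(1) by (simp add: bij_betw_def image_mset_mset_set)
    also have "\<dots> = image_mset (\<lambda>i. conj_char (u C) ?g (\<chi> C i)) (mset_set (I C))"
      unfolding multiset.map_comp
    proof (rule image_mset_cong)
      fix i assume "i \<in># mset_set (I C)"
      then have i: "i \<in> I C" using finite_index[OF C'] by simp
      have "conj_char (u' C) ?g' (\<chi>' C (\<psi> i)) = conj_char (u C) (?g' \<otimes> l) (\<chi> C i)"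
        unfolding eq[OF i] using conj_char_comp[OF u(2) l g'(1)] unfolding lu .
      also have "\<dots> = conj_char (u C) ?g (\<chi> C i)"
      proof (rule conj_char_cong[OF RSC_\<chi>[OF R C i] u(2)])
        have "(?g' \<otimes> l) \<otimes> u C \<otimes> inv (?g' \<otimes> l) = ?g' \<otimes> (l \<otimes> u C \<otimes> inv l) \<otimes> inv ?g'"
          using l g'(1) u(2) by (simp only: conj_conj)
        then show "(?g' \<otimes> l) \<otimes> u C \<otimes> inv (?g' \<otimes> l) = ?g \<otimes> u C \<otimes> inv ?g"
          unfolding lu g(2) g'(2) .
      qed (use g(1) g'(1) l in simp_all)
      finally show "((\<lambda>i. conj_char (u' C) ?g' (\<chi>' C i)) \<circ> \<psi>) i = conj_char (u C) ?g (\<chi> C i)" by simp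
    qed
    finally show ?thesis ..
  qed
  then show ?thesis unfolding class_multisets_def by (auto simp: restrict_def)
qed

lemma class_multisets_eq_imp_isomorphic:
  assumes R: "is_RSC F I (G, r, \<chi>, u)" and R': "is_RSC F I (G, r, \<chi>', u')"
    and eq: "class_multisets r I (G, r, \<chi>, u) = class_multisets r I (G, r, \<chi>', u')"
  shows "RSC_isomorphic I I (G, r, \<chi>, u) (G, r, \<chi>', u')"
proof -
  let ?g = "\<lambda>C. to_rep C (u C)" and ?g' = "\<lambda>C. to_rep C (u' C)"
  \<comment> \<open>The isomorphism has \<open>\<phi> = id\<close>; on each class it passes through the common representative.\<close>
  define h where "h C = inv (?g' C) \<otimes> ?g C" for C
  have h: "h C \<in> carrier G \<and> h C \<otimes> u C \<otimes> inv (h C) = u' C" if C: "C \<in> conj_classes G" for C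
  proof -
    note u = RSC_u[OF R C] and u' = RSC_u[OF R' C]
    note g = to_rep[OF C u(1)] and g' = to_rep[OF C u'(1)]
    have "h C \<otimes> u C \<otimes> inv (h C) = inv (?g' C) \<otimes> (?g C \<otimes> u C \<otimes> inv (?g C)) \<otimes> inv (inv (?g' C))"
      unfolding h_def using u(2) g(1) g'(1) by (simp only: conj_conj inv_closed)
    also have "\<dots> = inv (?g' C) \<otimes> (?g' C \<otimes> u' C \<otimes> inv (?g' C)) \<otimes> inv (inv (?g' C))"
      unfolding g(2) g'(2) ..
    also have "\<dots> = u' C" using u'(2) g'(1) by (simp add: m_assoc)
    finally show ?thesis using g(1) g'(1) by (simp add: h_def)
  qed
  have "\<exists>\<psi>. bij_betw \<psi> (I C) (I C) \<and>
      (\<forall>i \<in> I C. \<forall>x \<in> centralizer G (u C). \<chi>' C (\<psi> i) (h C \<otimes> x \<otimes> inv (h C)) = \<chi> C i x)"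
    if C: "C \<in> ramified_classes G r" for C
  proof -
    note C' = ramified[OF C]
    note u = RSC_u[OF R C'] and u' = RSC_u[OF R' C']
    note g = to_rep[OF C' u(1)] and g' = to_rep[OF C' u'(1)]
    have hC: "h C \<in> carrier G" "h C \<otimes> u C \<otimes> inv (h C) = u' C" using h[OF C'] by auto
    have "image_mset (\<lambda>i. conj_char (u C) (?g C) (\<chi> C i)) (mset_set (I C)) =
        image_mset (\<lambda>i. conj_char (u' C) (?g' C) (\<chi>' C i)) (mset_set (I C))"
      using fun_cong[OF eq, of C] C by (simp add: class_multisets_def)
    from image_mset_eq_implies_permutes[OF finite_index[OF C'] this]
    obtain \<psi> where \<psi>: "\<psi> permutes I C"
      "\<forall>i\<in>I C. conj_char (u C) (?g C) (\<chi> C i) = conj_char (u' C) (?g' C) (\<chi>' C (\<psi> i))" .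
    have "\<chi>' C (\<psi> i) (h C \<otimes> x \<otimes> inv (h C)) = \<chi> C i x"
      if i: "i \<in> I C" and x: "x \<in> centralizer G (u C)" for i x
    proof -
      have \<psi>i: "\<psi> i \<in> I C" using \<psi>(1) i by (simp add: permutes_in_image)
      have xG: "x \<in> carrier G" using x by (simp add: centralizer_def)
      have "\<chi>' C (\<psi> i) = conj_char (u' C) (inv (?g' C) \<otimes> ?g' C) (\<chi>' C (\<psi> i))"
        using conj_char_centralizer[OF RSC_\<chi>[OF R' C \<psi>i] u'(2)] g'(1) u'(2)
        by (simp add: centralizer_def)
      also have "\<dots> = conj_char (class_rep C) (inv (?g' C)) (conj_char (u' C) (?g' C) (\<chi>' C (\<psi> i)))"
        using conj_char_comp[OF u'(2) g'(1) inv_closed[OF g'(1)]] unfolding g'(2) by simp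
      also have "\<dots> = conj_char (u C) (h C) (\<chi> C i)"
        unfolding bspec[OF \<psi>(2) i, symmetric] h_def
        using conj_char_comp[OF u(2) g(1) inv_closed[OF g'(1)]] unfolding g(2) .
      finally have "\<chi>' C (\<psi> i) = conj_char (u C) (h C) (\<chi> C i)" .
      moreover have "h C \<otimes> x \<otimes> inv (h C) \<in> centralizer G (h C \<otimes> u C \<otimes> inv (h C))"
        using x conj_in_centralizer_iff[OF u(2) hC(1) xG] by simp
      moreover have "inv (h C) \<otimes> (h C \<otimes> x \<otimes> inv (h C)) \<otimes> h C = x"
        using hC(1) xG by (simp add: m_assoc)
      ultimately show ?thesis by (simp add: conj_char_def)
    qed
    then show ?thesis using permutes_imp_bij[OF \<psi>(1)] by blast
  qed
  then have "\<exists>h\<in>conj_classes G \<rightarrow> carrier G.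
      (\<forall>C\<in>conj_classes G. h C \<otimes> u C \<otimes> inv (h C) = u' C) \<and>
      (\<forall>C\<in>ramified_classes G r. \<exists>\<psi>. bij_betw \<psi> (I C) (I C) \<and>
        (\<forall>i\<in>I C. \<forall>x\<in>centralizer G (u C). \<chi>' C (\<psi> i) (h C \<otimes> x \<otimes> inv (h C)) = \<chi> C i x))"
    using h by (intro bexI[of _ h]) auto
  moreover have "(\<lambda>x. x) \<in> iso G G"
    by (simp add: iso_def hom_def bij_betw_def inj_on_def)
  ultimately show ?thesis
    unfolding RSC_isomorphic.simps by (intro bexI[of _ "\<lambda>x. x"]) simp_all
qed

text \<open>There are no constraints between the multisets at different classes, so the invariant takes all
conceivable values.\<close>

lemma class_multisets_image:
  "class_multisets r I ` RSCs F I G r =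
     (\<Pi>\<^sub>E C\<in>ramified_classes G r. multisets_of_size (characters F G (centralizer G (class_rep C))) (r C))"
  (is "?L = ?R")
proof
  show "?L \<subseteq> ?R"
  proof (rule image_subsetI)
    fix Q assume "Q \<in> RSCs F I G r"
    then obtain \<chi> u where Q: "Q = (G, r, \<chi>, u)" and R: "is_RSC F I (G, r, \<chi>, u)" by (auto simp: RSCs_def)
    have "image_mset (\<lambda>i. conj_char (u C) (to_rep C (u C)) (\<chi> C i)) (mset_set (I C))
        \<in> multisets_of_size (characters F G (centralizer G (class_rep C))) (r C)"
      if C: "C \<in> ramified_classes G r" for C
    proof -
      note C' = ramified[OF C]
      note u = RSC_u[OF R C']
      note g = to_rep[OF C' u(1)]
      have "conj_char (u C) (to_rep C (u C)) (\<chi> C i) \<in> characters F G (centralizer G (class_rep C))"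
        if "i \<in> I C" for i
        using conj_char_in_characters[OF RSC_\<chi>[OF R C that] u(2) g(1)] unfolding g(2) .
      then show ?thesis
        using finite_index[OF C'] card_index[OF C'] by (auto simp: multisets_of_size_def)
    qed
    then show "class_multisets r I Q \<in> ?R" by (auto simp: Q class_multisets_def)
  qed
  show "?R \<subseteq> ?L"
  proof
    fix M assume M: "M \<in> ?R"
    have "\<exists>f. image_mset f (mset_set (I C)) = M C" if C: "C \<in> ramified_classes G r" for C
      using M C finite_index[OF ramified[OF C]] card_index[OF ramified[OF C]]
      by (intro ex_image_mset_mset_set) (auto simp: multisets_of_size_def PiE_def Pi_def)
    then obtain f where f: "\<And>C. C \<in> ramified_classes G r \<Longrightarrow> image_mset (f C) (mset_set (I C)) = M C"
      by metis
    \<comment> \<open>A system that realizes \<open>M\<close> takes the representatives themselves as \<open>u\<close>, so that transport to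
      the representative is trivial.\<close>
    define u where "u = restrict class_rep (conj_classes G)"
    define \<chi> where "\<chi> = (\<lambda>C\<in>ramified_classes G r. \<lambda>i\<in>I C. f C i)"
    have f_char: "f C i \<in> characters F G (centralizer G (class_rep C))"
      if C: "C \<in> ramified_classes G r" and i: "i \<in> I C" for C i
    proof -
      have "f C i \<in># M C" using f[OF C, symmetric] i finite_index[OF ramified[OF C]] by auto
      then show ?thesis using M C by (auto simp: multisets_of_size_def PiE_def Pi_def)
    qed
    have "is_RSC F I (G, r, \<chi>, u)"
      using fin r I f_char class_rep_in is_group by (auto simp: u_def \<chi>_def ramified)
    then have "(G, r, \<chi>, u) \<in> RSCs F I G r" by (simp add: RSCs_def)
    moreover have "class_multisets r I (G, r, \<chi>, u) = M"
    proof
      fix C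
      show "class_multisets r I (G, r, \<chi>, u) C = M C"
      proof (cases "C \<in> ramified_classes G r")
        case True
        note C' = ramified[OF True]
        have s: "class_rep C \<in> C" "class_rep C \<in> carrier G"
          using class_rep_in[OF C'] conj_class_closed(1)[OF C'] by auto
        have uC: "u C = class_rep C" using C' by (simp add: u_def)
        note g = to_rep[OF C' s(1)]
        have "to_rep C (class_rep C) \<in> centralizer G (class_rep C)"
          using g s(2) by (simp add: centralizer_iff)
        then have "conj_char (u C) (to_rep C (u C)) (\<chi> C i) = f C i" if "i \<in> I C" for i
          using conj_char_centralizer[OF f_char[OF True that] s(2)] that True by (simp add: uC \<chi>_def)
        then have "image_mset (\<lambda>i. conj_char (u C) (to_rep C (u C)) (\<chi> C i)) (mset_set (I C)) = M C"
          using f[OF True] finite_index[OF C'] by (metis (mono_tags, lifting) finite_set_mset_mset_set image_mset_cong)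
        then show ?thesis using True by (simp add: class_multisets_def)
      next
        case False
        then show ?thesis using M by (auto simp: class_multisets_def PiE_def extensional_def)
      qed
    qed
    ultimately show "M \<in> ?L" by blast
  qed
qed

theorem num_RSC_classes_eq:
  "num_RSC_classes F I G r = (\<Prod>C\<in>ramified_classes G r. (gamma F G C + r C - 1) choose r C)"
proof -
  let ?A = "RSCs F I G r"
  have "{(R, R') \<in> ?A \<times> ?A. RSC_isomorphic I I R R'} =
        {(R, R') \<in> ?A \<times> ?A. class_multisets r I R = class_multisets r I R'}"
  proof -
    have "RSC_isomorphic I I R R' \<longleftrightarrow> class_multisets r I R = class_multisets r I R'"
      if "R \<in> ?A" "R' \<in> ?A" for R R'
      using that isomorphic_imp_class_multisets_eq class_multisets_eq_imp_isomorphic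
      unfolding RSCs_def by blast
    then show ?thesis by auto
  qed
  then have "num_RSC_classes F I G r = card (class_multisets r I ` ?A)"
    unfolding num_RSC_classes_def by (simp only: card_quotient_kernel)
  also have "\<dots> = (\<Prod>C\<in>ramified_classes G r.
      card (multisets_of_size (characters F G (centralizer G (class_rep C))) (r C)))"
    unfolding class_multisets_image using finite_conj_classes[OF fin]
    by (intro card_PiE) (simp add: ramified_classes_def)
  also have "\<dots> = (\<Prod>C\<in>ramified_classes G r. (gamma F G C + r C - 1) choose r C)"
  proof (rule prod.cong[OF refl])
    fix C assume C: "C \<in> ramified_classes G r"
    have "class_rep C \<in> carrier G"
      using class_rep_in[OF ramified[OF C]] conj_class_closed(1)[OF ramified[OF C]] by blast
    then show "card (multisets_of_size (characters F G (centralizer G (class_rep C))) (r C)) =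
        (gamma F G C + r C - 1) choose r C"
      unfolding gamma_def class_rep_def[symmetric]
      by (intro card_multisets_of_size finite_characters fin)
  qed
  finally show ?thesis .
qed

end

section \<open>The centralizer of a permutation\<close>

locale finite_permutation =
  fixes S :: "'a set" and \<sigma> :: "'a \<Rightarrow> 'a"
  assumes fin: "finite S" and perm: "\<sigma> permutes S"
begin

abbreviation orb :: "'a \<Rightarrow> 'a set" where "orb \<equiv> Orbits.orbit \<sigma>"
abbreviation period :: "'a \<Rightarrow> nat" where "period x \<equiv> card (orb x)"

definition cent :: "('a \<Rightarrow> 'a) set" where
  "cent = {z. z permutes S \<and> z \<circ> \<sigma> = \<sigma> \<circ> z}"

lemma permutation: "permutation \<sigma>"
  using fin perm by (auto simp: permutation_permutes)

lemma self_in_orb [simp]: "x \<in> orb x"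
  by (rule permutation_self_in_orbit[OF permutation])

lemma orb_altdef: "y \<in> orb x \<longleftrightarrow> (\<exists>k. y = (\<sigma> ^^ k) x)"
  by (auto simp: orbit_altdef_permutation[OF permutation])

lemma orb_eq_iff: "orb x = orb y \<longleftrightarrow> x \<in> orb y"
proof
  show "x \<in> orb y" if "orb x = orb y" using self_in_orb[of x] that by simp
  show "orb x = orb y" if "x \<in> orb y"
    using orbit_cyclic_eq3[OF cyclic_on_orbit'[OF permutation] that] .
qed

lemma funpow_in_orb [simp]: "(\<sigma> ^^ k) x \<in> orb x"
  by (auto simp: orb_altdef)

lemma orb_funpow [simp]: "orb ((\<sigma> ^^ k) x) = orb x"
  by (simp add: orb_eq_iff)

lemma finite_orb [simp]: "finite (orb x)"
  by (rule finite_orbit) simp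

lemma period_pos: "period x > 0"
  by (metis card_gt_0_iff finite_orb self_in_orb empty_iff)

lemma orb_subset: "x \<in> S \<Longrightarrow> orb x \<subseteq> S"
  by (rule permutes_orbit_subset[OF perm])

text \<open>The cycle of \<open>x\<close> is a torsor for the integers modulo its length.\<close>

lemma funpow_eq_iff: "(\<sigma> ^^ k) x = (\<sigma> ^^ l) x \<longleftrightarrow> [k = l] (mod period x)"
proof -
  let ?N = "funpow_dist1 \<sigma> x x"
  have orb: "orb x = (\<lambda>n. (\<sigma> ^^ n) x) ` {0..<?N}"
    by (rule orbit_conv_funpow_dist1) simp
  have inj: "inj_on (\<lambda>n. (\<sigma> ^^ n) x) {0..<?N}"
    by (rule inj_on_funpow_dist1) simp
  have N: "period x = ?N" unfolding orb card_image[OF inj] by simp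
  have ret: "(\<sigma> ^^ ?N) x = x" by (rule funpow_dist1_prop) simp
  have "(\<sigma> ^^ k) x = (\<sigma> ^^ l) x \<longleftrightarrow> (\<sigma> ^^ (k mod ?N)) x = (\<sigma> ^^ (l mod ?N)) x"
    by (simp only: funpow_mod_eq[OF ret])
  also have "\<dots> \<longleftrightarrow> k mod ?N = l mod ?N"
  proof (rule inj_on_eq_iff[OF inj])
    show "k mod ?N \<in> {0..<?N}" "l mod ?N \<in> {0..<?N}" by (simp_all del: mod_by_Suc_0)
  qed
  finally show ?thesis unfolding N cong_def .
qed

lemma funpow_fix_iff: "(\<sigma> ^^ k) x = x \<longleftrightarrow> period x dvd k"
  using funpow_eq_iff[of k x 0] by (simp add: cong_0_iff)

lemma centD:
  assumes "z \<in> cent"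
  shows "z permutes S" "z (\<sigma> x) = \<sigma> (z x)" "inj z"
  using assms permutes_inj by (auto simp: cent_def fun_eq_iff)

lemma centI: "z permutes S \<Longrightarrow> (\<And>x. x \<in> S \<Longrightarrow> z (\<sigma> x) = \<sigma> (z x)) \<Longrightarrow> z \<in> cent"
  unfolding cent_def using permutes_not_in[of z S] permutes_not_in[OF perm] permutes_in_image[OF perm]
  by (auto simp: fun_eq_iff) metis

lemma id_in_cent [simp]: "id \<in> cent"
  by (simp add: cent_def permutes_id)

lemma comp_in_cent: "z \<in> cent \<Longrightarrow> w \<in> cent \<Longrightarrow> z \<circ> w \<in> cent"
  by (auto simp: cent_def fun_eq_iff intro: permutes_compose)

lemma funpow_in_cent: "z \<in> cent \<Longrightarrow> z ^^ k \<in> cent"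
  by (induction k) (auto intro: comp_in_cent)

lemma cent_funpow: "z \<in> cent \<Longrightarrow> z ((\<sigma> ^^ k) x) = (\<sigma> ^^ k) (z x)"
  by (induction k) (simp_all add: centD(2))

lemma cent_image_orb: "z \<in> cent \<Longrightarrow> z ` orb x = orb (z x)"
proof -
  assume z: "z \<in> cent"
  have "orb x = range (\<lambda>k. (\<sigma> ^^ k) x)" for x by (auto simp: orb_altdef)
  then show ?thesis by (simp add: image_image cent_funpow[OF z])
qed

lemma cent_in_orb_iff: "z \<in> cent \<Longrightarrow> z y \<in> orb (z x) \<longleftrightarrow> y \<in> orb x"
  unfolding cent_image_orb[symmetric] by (simp add: inj_image_mem_iff[OF centD(3)])

lemma cent_period: "z \<in> cent \<Longrightarrow> period (z x) = period x"
  unfolding cent_image_orb[symmetric] by (rule card_image) (meson centD(3) inj_on_subset subset_UNIV)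

lemma cent_in_S: "z \<in> cent \<Longrightarrow> z x \<in> S \<longleftrightarrow> x \<in> S"
  using centD(1) by (simp add: permutes_in_image)

lemma cent_eq_on_orb:
  assumes "z \<in> cent" "w \<in> cent" "z x = w x" "y \<in> orb x"
  shows "z y = w y"
  using assms by (auto simp: orb_altdef cent_funpow)


definition rot :: "'a \<Rightarrow> 'a \<Rightarrow> 'a" where "rot x = perm_restrict \<sigma> (orb x)"

lemma rot_simps: "p \<in> orb x \<Longrightarrow> rot x p = \<sigma> p" "p \<notin> orb x \<Longrightarrow> rot x p = p"
  by (auto simp: rot_def perm_restrict_simps)

lemma step_in_orb_iff [simp]: "\<sigma> p \<in> orb x \<longleftrightarrow> p \<in> orb x"
  using orb_funpow[of 1 p] orb_eq_iff[of "\<sigma> p" x] orb_eq_iff[of p x] by simp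

lemma rot_in_cent:
  assumes "x \<in> S" shows "rot x \<in> cent"
proof (rule centI)
  have "inj_on (rot x) S"
  proof (rule inj_onI)
    fix p q assume "rot x p = rot x q"
    then show "p = q"
      using step_in_orb_iff permutes_inj[OF perm]
      by (cases "p \<in> orb x"; cases "q \<in> orb x") (auto simp: rot_simps inj_eq)
  qed
  moreover have "rot x ` S \<subseteq> S"
    using permutes_in_image[OF perm] by (auto simp: rot_def perm_restrict_def)
  ultimately have "bij_betw (rot x) S S" using fin by (simp add: bij_betw_def endo_inj_surj)
  then show "rot x permutes S"
    using orb_subset[OF assms] by (intro bij_imp_permutes) (auto intro: rot_simps)
  show "rot x (\<sigma> p) = \<sigma> (rot x p)" for p
    by (cases "p \<in> orb x") (simp_all add: rot_simps)
qed

lemma rot_funpow: "p \<in> orb x \<Longrightarrow> (rot x ^^ k) p = (\<sigma> ^^ k) p" "p \<notin> orb x \<Longrightarrow> (rot x ^^ k) p = p"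
proof -
  assume p: "p \<in> orb x"
  have "(\<sigma> ^^ k) p \<in> orb x" for k
    using p orb_funpow[of k p] orb_eq_iff by metis
  then show "(rot x ^^ k) p = (\<sigma> ^^ k) p" by (induction k) (simp_all add: rot_simps)
next
  show "p \<notin> orb x \<Longrightarrow> (rot x ^^ k) p = p" by (induction k) (simp_all add: rot_simps)
qed

lemma rot_funpow_period: "period x dvd k \<Longrightarrow> rot x ^^ k = id"
proof
  fix p assume k: "period x dvd k"
  show "(rot x ^^ k) p = id p"
  proof (cases "p \<in> orb x")
    case True
    then have "period p = period x" by (simp add: orb_eq_iff[symmetric])
    then show ?thesis using True k by (simp add: rot_funpow funpow_fix_iff)
  qed (simp add: rot_funpow)
qed

text \<open>The exchange of two cycles of equal length that matches \<open>\<sigma>\<^sup>k x\<close> with \<open>\<sigma>\<^sup>k y\<close>.\<close>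

definition swap :: "'a \<Rightarrow> 'a \<Rightarrow> 'a \<Rightarrow> 'a" where
  "swap x y p = (if p \<in> orb x then (\<sigma> ^^ funpow_dist \<sigma> x p) y
     else if p \<in> orb y then (\<sigma> ^^ funpow_dist \<sigma> y p) x else p)"

definition swappable :: "'a \<Rightarrow> 'a \<Rightarrow> bool" where
  "swappable x y \<longleftrightarrow> x \<in> S \<and> y \<in> S \<and> period x = period y \<and> y \<notin> orb x"

lemma swappable_notin: "swappable x y \<Longrightarrow> x \<notin> orb y"
  using orb_eq_iff[of x y] by (auto simp: swappable_def)

lemma swap_simps:
  assumes "swappable x y"
  shows "swap x y ((\<sigma> ^^ k) x) = (\<sigma> ^^ k) y" "swap x y ((\<sigma> ^^ k) y) = (\<sigma> ^^ k) x"
    "p \<notin> orb x \<Longrightarrow> p \<notin> orb y \<Longrightarrow> swap x y p = p"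
proof -
  have dist: "[funpow_dist \<sigma> u ((\<sigma> ^^ k) u) = k] (mod period u)" for u
    using funpow_dist_prop[OF funpow_in_orb[of k u]] by (simp add: funpow_eq_iff)
  have per: "period x = period y" using assms by (simp add: swappable_def)
  show "swap x y ((\<sigma> ^^ k) x) = (\<sigma> ^^ k) y"
    using dist[of x] unfolding per by (simp add: swap_def funpow_eq_iff)
  have "(\<sigma> ^^ k) y \<notin> orb x"
    using assms orb_eq_iff[of "(\<sigma> ^^ k) y" x] orb_eq_iff[of y x] by (simp add: swappable_def)
  then show "swap x y ((\<sigma> ^^ k) y) = (\<sigma> ^^ k) x"
    using dist[of y] unfolding per[symmetric] by (simp add: swap_def funpow_eq_iff)
qed (simp add: swap_def)

lemma swap_apply:
  assumes "swappable x y" shows "swap x y x = y" "swap x y y = x"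
  using swap_simps(1,2)[OF assms, of 0] by simp_all

lemma orb_cases:
  obtains k where "p = (\<sigma> ^^ k) x" | k where "p = (\<sigma> ^^ k) y" | "p \<notin> orb x" "p \<notin> orb y"
  by (auto simp: orb_altdef)

lemma swap_swap: "swappable x y \<Longrightarrow> swap x y (swap x y p) = p"
  by (rule orb_cases[where p = p and x = x and y = y]) (simp_all add: swap_simps)

lemma swap_in_cent:
  assumes "swappable x y" shows "swap x y \<in> cent"
proof (rule centI)
  have "swap x y p = p" if "p \<notin> S" for p
    using that assms orb_subset by (intro swap_simps(3)[OF assms]) (auto simp: swappable_def)
  moreover have "bij (swap x y)"
    using swap_swap[OF assms] by (intro o_bij[of "swap x y"]) (auto simp: fun_eq_iff)
  ultimately show "swap x y permutes S" by (auto simp: permutes_def bij_iff)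
  show "swap x y (\<sigma> p) = \<sigma> (swap x y p)" for p
  proof (rule orb_cases[where p = p and x = x and y = y])
    fix k assume "p = (\<sigma> ^^ k) x"
    then show ?thesis using swap_simps(1)[OF assms, of k] swap_simps(1)[OF assms, of "Suc k"] by simp
  next
    fix k assume "p = (\<sigma> ^^ k) y"
    then show ?thesis using swap_simps(2)[OF assms, of k] swap_simps(2)[OF assms, of "Suc k"] by simp
  next
    assume "p \<notin> orb x" "p \<notin> orb y"
    then show ?thesis by (simp add: swap_simps(3)[OF assms])
  qed
qed

lemma rot_conj:
  assumes "z \<in> cent" shows "z \<circ> rot x = rot (z x) \<circ> z"
proof
  fix p show "(z \<circ> rot x) p = (rot (z x) \<circ> z) p"
    by (cases "p \<in> orb x") (simp_all add: rot_simps cent_in_orb_iff[OF assms] centD(2)[OF assms])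
qed

lemma swappable_cent: "z \<in> cent \<Longrightarrow> swappable x y \<Longrightarrow> swappable (z x) (z y)"
  by (simp add: swappable_def cent_in_S cent_period cent_in_orb_iff)

lemma swap_conj:
  assumes z: "z \<in> cent" and sw: "swappable x y"
  shows "z \<circ> swap x y = swap (z x) (z y) \<circ> z"
proof
  note sw' = swappable_cent[OF z sw]
  fix p show "(z \<circ> swap x y) p = (swap (z x) (z y) \<circ> z) p"
    by (rule orb_cases[where p = p and x = x and y = y])
      (simp_all add: swap_simps[OF sw] swap_simps[OF sw'] cent_funpow[OF z] cent_in_orb_iff[OF z])
qed

text \<open>The centralizer acts transitively on the points that lie in cycles of a given length, and the
moving element can be chosen to fix all other cycles.\<close>

lemma ex_cent_moving:
  assumes "x \<in> S" "y \<in> S" "period x = period y"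
  shows "\<exists>z\<in>cent. z x = y \<and> (\<forall>p. p \<notin> orb x \<longrightarrow> p \<notin> orb y \<longrightarrow> z p = p)"
proof (cases "y \<in> orb x")
  case True
  then obtain k where k: "y = (\<sigma> ^^ k) x" by (auto simp: orb_altdef)
  have "(rot x ^^ k) x = y" by (simp add: k rot_funpow)
  moreover have "\<forall>p. p \<notin> orb x \<longrightarrow> (rot x ^^ k) p = p" by (simp add: rot_funpow)
  ultimately show ?thesis using funpow_in_cent[OF rot_in_cent[OF assms(1)]] by blast
next
  case False
  then have "swappable x y" using assms by (simp add: swappable_def)
  then show ?thesis using swap_in_cent swap_apply swap_simps(3) by blast
qed

text \<open>Pairs of points in different cycles of equal length also form one orbit of the centralizer. So, for
each length, all \<open>rot x\<close> are conjugate in the centralizer, and so are all \<open>swap x y\<close>.\<close>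

lemma ex_cent_moving_pair:
  assumes 1: "swappable x y" and 2: "swappable x' y'" and "period x = period x'"
  shows "\<exists>z\<in>cent. z x = x' \<and> z y = y'"
proof -
  have S: "x \<in> S" "y \<in> S" "x' \<in> S" "y' \<in> S" using 1 2 by (auto simp: swappable_def)
  \<comment> \<open>Once \<open>x\<close> is in place, the image of \<open>y\<close> can be moved to \<open>y'\<close> by an element that fixes the
    cycle of \<open>x'\<close>.\<close>
  obtain z where z: "z \<in> cent" "z x = x'" using ex_cent_moving[of x x'] assms S by blast
  have "swappable x' (z y)" using swappable_cent[OF z(1) 1] z(2) by simp
  then have zy: "x' \<notin> orb (z y)" "period (z y) = period x'"
    using swappable_notin by (auto simp: swappable_def)
  have "period (z y) = period y'" using zy 2 by (simp add: swappable_def)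
  then obtain w where w: "w \<in> cent" "w (z y) = y'" "\<And>p. p \<notin> orb (z y) \<Longrightarrow> p \<notin> orb y' \<Longrightarrow> w p = p"
    using ex_cent_moving[of "z y" y'] S cent_in_S[OF z(1)] by blast
  have "w x' = x'" using w(3)[OF zy(1) swappable_notin[OF 2]] .
  then show ?thesis using z w comp_in_cent[of w z] by (intro bexI[of _ "w \<circ> z"]) simp_all
qed

text \<open>In other words, the elements \<open>rot x\<close> and \<open>swap x y\<close> generate the centralizer: if \<open>z\<close> moves
\<open>x\<close>, then a power of \<open>rot x\<close> or \<open>swap x (z x)\<close> moves \<open>z x\<close> back to \<open>x\<close> and leaves every
fixed point of \<open>z\<close> in place.\<close>

lemma cent_induct [consumes 1, case_names id rot swap]:
  assumes "z \<in> cent"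
    and id: "P id"
    and rot: "\<And>x w. x \<in> S \<Longrightarrow> w \<in> cent \<Longrightarrow> P w \<Longrightarrow> P (rot x \<circ> w)"
    and swap: "\<And>x y w. swappable x y \<Longrightarrow> w \<in> cent \<Longrightarrow> P w \<Longrightarrow> P (swap x y \<circ> w)"
  shows "P z"
  using assms(1)
proof (induction "card {p \<in> S. z p \<noteq> p}" arbitrary: z rule: less_induct)
  case less
  show ?case
  proof (cases "\<forall>x\<in>S. z x = x")
    case True
    then have "z = id" using permutes_not_in[OF centD(1)[OF less.prems]] by (auto simp: fun_eq_iff)
    then show ?thesis using id by simp
  next
    case False
    then obtain x where x: "x \<in> S" "z x \<noteq> x" by blast
    note z = less.prems
    have IH: "P w" if "w \<in> cent" "w x = x" "\<And>p. z p = p \<Longrightarrow> w p = p" for w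
    proof (rule less.hyps[OF _ that(1)])
      show "card {p \<in> S. w p \<noteq> p} < card {p \<in> S. z p \<noteq> p}"
        by (rule psubset_card_mono) (use fin x that(2,3) in auto)
    qed
    have fixed: "p \<notin> orb x" if "z p = p" for p
      using cent_eq_on_orb[OF z id_in_cent, of p x] that x orb_eq_iff[of x p] orb_eq_iff[of p x] by auto
    show ?thesis
    proof (cases "z x \<in> orb x")
      case True
      then obtain k where k: "z x = (\<sigma> ^^ k) x" by (auto simp: orb_altdef)
      \<comment> \<open>The exponent \<open>m\<close> is an additive inverse of \<open>k\<close> modulo the period, in the natural numbers.\<close>
      define m where "m = (period x - 1) * k"
      have "m + k = Suc (period x - 1) * k" by (simp add: m_def)
      also have "Suc (period x - 1) = period x" using period_pos[of x] by simp
      finally have km: "m + k = period x * k" .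
      define w where "w = (rot x ^^ m) \<circ> z"
      have w: "w \<in> cent" unfolding w_def by (intro comp_in_cent funpow_in_cent rot_in_cent x z)
      have "w x = (\<sigma> ^^ (m + k)) x" by (simp add: w_def k rot_funpow funpow_add)
      then have wx: "w x = x" by (simp add: km funpow_fix_iff)
      have "w p = p" if "z p = p" for p
        using fixed[OF that] that by (simp add: w_def rot_funpow)
      then have "P w" using IH[of w] w wx by blast
      have "P ((rot x ^^ j) \<circ> w)" for j
      proof (induction j)
        case (Suc j)
        then have "P (rot x \<circ> ((rot x ^^ j) \<circ> w))"
          by (intro rot x comp_in_cent funpow_in_cent rot_in_cent w)
        then show ?case by (simp add: o_def)
      qed (use \<open>P w\<close> in simp)
      moreover have "(rot x ^^ k) \<circ> w = z"
      proof -
        have "(rot x ^^ k) \<circ> w = (rot x ^^ (k + m)) \<circ> z" by (simp add: w_def o_assoc funpow_add)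
        also have "rot x ^^ (k + m) = id" by (rule rot_funpow_period) (metis add.commute km dvd_triv_left)
        finally show ?thesis by (simp only: id_comp)
      qed
      ultimately show ?thesis by metis
    next
      case False
      have sw: "swappable x (z x)"
        using x False cent_in_S[OF z] cent_period[OF z] by (simp add: swappable_def)
      define w where "w = swap x (z x) \<circ> z"
      have w: "w \<in> cent" unfolding w_def by (intro comp_in_cent swap_in_cent sw z)
      have wx: "w x = x" by (simp add: w_def swap_apply[OF sw])
      have "w p = p" if p: "z p = p" for p
      proof -
        have "p \<notin> orb (z x)" using fixed[OF p] cent_in_orb_iff[OF z, of p x] p by simp
        then show ?thesis using fixed[OF p] p by (simp add: w_def swap_simps(3)[OF sw])
      qed
      then have "P w" using IH[of w] w wx by blast
      then have "P (swap x (z x) \<circ> w)" by (rule swap[OF sw w])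
      moreover have "swap x (z x) \<circ> w = z" by (auto simp: w_def swap_swap[OF sw])
      ultimately show ?thesis by simp
    qed
  qed
qed

end

section \<open>Total rotation and sign\<close>

context finite_permutation
begin

definition orbits :: "'a set set" where "orbits = orb ` S"
definition orbits_of_size :: "nat \<Rightarrow> 'a set set" where "orbits_of_size i = {A \<in> orbits. card A = i}"
text \<open>Points in a cycle are measured from a base point. Another choice of base points would
change \<open>shift\<close> below by a coboundary, and \<open>turns\<close> not at all modulo the length.\<close>

definition base :: "'a set \<Rightarrow> 'a" where "base A = (SOME x. x \<in> A)"

lemma finite_orbits_of_size [simp]: "finite (orbits_of_size i)"
  using fin by (simp add: orbits_def orbits_of_size_def)

lemma base_orb: assumes "A \<in> orbits" shows "base A \<in> A" "base A \<in> S" "orb (base A) = A"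
proof -
  obtain x where x: "x \<in> S" "A = orb x" using assms by (auto simp: orbits_def)
  show b: "base A \<in> A" unfolding base_def using x by (intro someI[of "\<lambda>y. y \<in> A" x]) simp
  then show "base A \<in> S" "orb (base A) = A" using x orb_subset orb_eq_iff by auto
qed

lemma orb_in_orbits: "x \<in> S \<Longrightarrow> orb x \<in> orbits"
  by (simp add: orbits_def)

lemma cent_image_orbits: "z \<in> cent \<Longrightarrow> A \<in> orbits \<Longrightarrow> z ` A \<in> orbits"
  by (auto simp: orbits_def cent_image_orb cent_in_S)

lemma bij_betw_image_orbits:
  assumes z: "z \<in> cent" shows "bij_betw ((`) z) (orbits_of_size i) (orbits_of_size i)"
proof -
  have "inj_on ((`) z) (orbits_of_size i)"
    using centD(3)[OF z] by (auto simp: inj_on_def inj_image_eq_iff)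
  moreover have "(`) z ` orbits_of_size i \<subseteq> orbits_of_size i"
    using cent_image_orbits[OF z] centD(3)[OF z]
    by (auto simp: orbits_of_size_def card_image inj_on_subset[of z UNIV])
  ultimately show ?thesis by (simp add: bij_betw_def endo_inj_surj)
qed

text \<open>By how many steps \<open>z\<close> misses the base point of the image of the cycle \<open>A\<close>. Only the residue
modulo the length of the cycle matters.\<close>

definition shift :: "('a \<Rightarrow> 'a) \<Rightarrow> 'a set \<Rightarrow> nat" where
  "shift z A = funpow_dist \<sigma> (base (z ` A)) (z (base A))"

text \<open>The centralizer is a product, over the lengths \<open>i\<close>, of wreath products of a cyclic group of order
\<open>i\<close> by the symmetric group of the cycles of length \<open>i\<close>. Its homomorphisms to abelian groups factor through
the total rotation modulo \<open>i\<close> and the sign of the permutation of the cycles, for all \<open>i\<close>; these are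
\<open>turns\<close> and, written as an exponent modulo 2, \<open>flips\<close>.\<close>

definition turns :: "nat \<Rightarrow> ('a \<Rightarrow> 'a) \<Rightarrow> nat" where
  "turns i z = (\<Sum>A\<in>orbits_of_size i. shift z A)"

definition flips :: "nat \<Rightarrow> ('a \<Rightarrow> 'a) \<Rightarrow> nat" where
  "flips i z = (if sign_on (orbits_of_size i) ((`) z) = 1 then 0 else 1)"

lemma shift:
  assumes "z \<in> cent" "A \<in> orbits"
  shows "(\<sigma> ^^ shift z A) (base (z ` A)) = z (base A)"
  unfolding shift_def
proof (rule funpow_dist_prop)
  have "orb (base (z ` A)) = z ` A" by (rule base_orb(3)[OF cent_image_orbits[OF assms]])
  then show "z (base A) \<in> orb (base (z ` A))" using base_orb(1)[OF assms(2)] by auto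
qed

lemma shift_cong:
  assumes "z \<in> cent" "A \<in> orbits" "(\<sigma> ^^ k) (base (z ` A)) = z (base A)"
  shows "[shift z A = k] (mod card A)"
proof -
  have "period (base (z ` A)) = card A"
    using base_orb(3)[OF cent_image_orbits[OF assms(1,2)]] centD(3)[OF assms(1)]
    by (simp add: card_image inj_on_subset[of z UNIV])
  moreover have "(\<sigma> ^^ shift z A) (base (z ` A)) = (\<sigma> ^^ k) (base (z ` A))"
    using shift assms by simp
  ultimately show ?thesis by (simp add: funpow_eq_iff)
qed

text \<open>The cocycle identity from which the additivity of the total rotation follows by summation.\<close>

lemma shift_comp:
  assumes "z \<in> cent" "w \<in> cent" "A \<in> orbits"
  shows "[shift (z \<circ> w) A = shift w A + shift z (w ` A)] (mod card A)"
proof (rule shift_cong[OF comp_in_cent[OF assms(1,2)] assms(3)])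
  have "(z \<circ> w) (base A) = (\<sigma> ^^ shift w A) (z (base (w ` A)))"
    using cent_funpow[OF assms(1)] shift[OF assms(2,3)] by (metis comp_apply)
  also have "\<dots> = (\<sigma> ^^ (shift w A + shift z (w ` A))) (base ((z \<circ> w) ` A))"
    using shift[OF assms(1) cent_image_orbits[OF assms(2,3)]] by (simp add: funpow_add image_comp)
  finally show "(\<sigma> ^^ (shift w A + shift z (w ` A))) (base ((z \<circ> w) ` A)) = (z \<circ> w) (base A)" ..
qed

lemma turns_comp:
  assumes "z \<in> cent" "w \<in> cent"
  shows "[turns i (z \<circ> w) = turns i z + turns i w] (mod i)"
proof -
  have "[turns i (z \<circ> w) = (\<Sum>A\<in>orbits_of_size i. shift w A + shift z (w ` A))] (mod i)"
    unfolding turns_def using shift_comp[OF assms]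
    by (intro cong_sum) (auto simp: orbits_of_size_def)
  also have "(\<Sum>A\<in>orbits_of_size i. shift w A + shift z (w ` A)) = turns i w + turns i z"
    unfolding turns_def sum.distrib
    using sum.reindex_bij_betw[OF bij_betw_image_orbits[OF assms(2)], of "shift z" i] by simp
  finally show ?thesis by (subst add.commute)
qed

lemma flips_comp:
  assumes "z \<in> cent" "w \<in> cent"
  shows "[flips i (z \<circ> w) = flips i z + flips i w] (mod 2)"
proof -
  let ?s = "\<lambda>z. sign_on (orbits_of_size i) ((`) z)"
  have comp: "(`) (z \<circ> w) = (`) z \<circ> (`) w" by (auto simp: image_comp)
  have "?s (z \<circ> w) = ?s z * ?s w"
    unfolding comp using bij_betw_image_orbits assms by (intro sign_on_compose) simp_all
  moreover have "?s v = 1 \<or> ?s v = -1" for v unfolding sign_on_def by (simp add: sign_def)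
  from this[of z] this[of w] calculation show ?thesis
    unfolding flips_def by (auto simp: cong_def)
qed

lemma rot_image: "x \<in> S \<Longrightarrow> A \<in> orbits \<Longrightarrow> rot x ` A = A"
proof -
  assume x: "x \<in> S" and "A \<in> orbits"
  then obtain y where y: "y \<in> S" "A = orb y" by (auto simp: orbits_def)
  have "rot x y \<in> orb y" by (cases "y \<in> orb x") (simp_all add: rot_simps)
  then show ?thesis using cent_image_orb[OF rot_in_cent[OF x]] y orb_eq_iff by simp
qed

lemma flips_rot: "x \<in> S \<Longrightarrow> flips i (rot x) = 0"
proof -
  assume "x \<in> S"
  then have "sign_on (orbits_of_size i) ((`) (rot x)) = sign_on (orbits_of_size i) id"
    by (intro sign_on_cong) (auto simp: rot_image orbits_of_size_def)
  then show ?thesis by (simp add: flips_def)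
qed

lemma turns_rot:
  assumes x: "x \<in> S"
  shows "[turns i (rot x) = (if i = period x then 1 else 0)] (mod i)"
proof -
  have "[turns i (rot x) = (\<Sum>A\<in>orbits_of_size i. if A = orb x then 1 else 0)] (mod i)"
    unfolding turns_def
  proof (rule cong_sum)
    fix A assume A: "A \<in> orbits_of_size i"
    then have A': "A \<in> orbits" "card A = i" by (auto simp: orbits_of_size_def)
    have "[shift (rot x) A = (if A = orb x then 1 else 0)] (mod card A)"
    proof (rule shift_cong[OF rot_in_cent[OF x] A'(1)])
      have "base A \<in> orb x \<longleftrightarrow> A = orb x" using base_orb(3)[OF A'(1)] orb_eq_iff by metis
      then show "(\<sigma> ^^ (if A = orb x then 1 else 0)) (base (rot x ` A)) = rot x (base A)"
        unfolding rot_image[OF x A'(1)] using rot_simps[of "base A" x] by (cases "A = orb x") simp_all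
    qed
    then show "[shift (rot x) A = (if A = orb x then 1 else 0)] (mod i)" using A' by simp
  qed
  also have "(\<Sum>A\<in>orbits_of_size i. if A = orb x then 1 else 0) = (if orb x \<in> orbits_of_size i then 1 else 0 :: nat)"
    by simp
  also have "orb x \<in> orbits_of_size i \<longleftrightarrow> i = period x"
    using orb_in_orbits[OF x] by (auto simp: orbits_of_size_def)
  finally show ?thesis .
qed

context
  fixes A B
  assumes A: "A \<in> orbits" and B: "B \<in> orbits" and AB: "A \<noteq> B" and card: "card A = card B"
begin

lemma swappable_base: "swappable (base A) (base B)"
  using base_orb[OF A] base_orb[OF B] AB card orb_eq_iff unfolding swappable_def by metis

text \<open>An exchange of two cycles that matches their base points has no rotational part.\<close>

lemma swap_base_image:
  assumes "C \<in> orbits"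
  shows "swap (base A) (base B) ` C = Transposition.transpose A B C"
    "swap (base A) (base B) (base C) = base (Transposition.transpose A B C)"
proof -
  show 2: "swap (base A) (base B) (base C) = base (Transposition.transpose A B C)"
  proof -
    consider "C = A" | "C = B" | "C \<noteq> A" "C \<noteq> B" by blast
    then show ?thesis
    proof cases
      case 3
      then have "base C \<notin> orb (base A)" "base C \<notin> orb (base B)"
        using base_orb(3)[OF A] base_orb(3)[OF B] base_orb(3)[OF assms] orb_eq_iff by metis+
      then show ?thesis using 3 swap_simps(3)[OF swappable_base] by (simp add: transpose_apply_other)
    qed (simp_all add: swap_apply[OF swappable_base])
  qed
  have "Transposition.transpose A B C \<in> orbits" using A B assms by (auto simp: Transposition.transpose_def)
  then have "orb (swap (base A) (base B) (base C)) = Transposition.transpose A B C"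
    unfolding 2 by (rule base_orb(3))
  then show "swap (base A) (base B) ` C = Transposition.transpose A B C"
    using cent_image_orb[OF swap_in_cent[OF swappable_base], of "base C"] base_orb(3)[OF assms] by simp
qed

lemma turns_swap: "[turns i (swap (base A) (base B)) = 0] (mod i)"
proof -
  have "[turns i (swap (base A) (base B)) = (\<Sum>C\<in>orbits_of_size i. 0)] (mod i)"
    unfolding turns_def
  proof (rule cong_sum)
    fix C assume "C \<in> orbits_of_size i"
    then have C: "C \<in> orbits" "card C = i" by (auto simp: orbits_of_size_def)
    show "[shift (swap (base A) (base B)) C = 0] (mod i)"
      using shift_cong[OF swap_in_cent[OF swappable_base] C(1), of 0] swap_base_image[OF C(1)] C(2)
      by simp
  qed
  then show ?thesis by simp
qed

lemma flips_swap: "flips i (swap (base A) (base B)) = (if i = card A then 1 else 0)"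
proof -
  have "sign_on (orbits_of_size i) ((`) (swap (base A) (base B))) =
        sign_on (orbits_of_size i) (Transposition.transpose A B)"
    using swap_base_image by (intro sign_on_cong) (auto simp: orbits_of_size_def)
  also have "\<dots> = (if i = card A then -1 else 1)"
  proof (cases "i = card A")
    case True
    then show ?thesis using A B AB card by (simp add: sign_on_transpose orbits_of_size_def)
  next
    case False
    have "sign_on (orbits_of_size i) (Transposition.transpose A B) = sign_on (orbits_of_size i) id"
    proof (rule sign_on_cong[OF refl])
      fix C assume "C \<in> orbits_of_size i"
      then have "C \<noteq> A" "C \<noteq> B" using False card by (auto simp: orbits_of_size_def)
      then show "Transposition.transpose A B C = id C" by (simp add: transpose_apply_other)
    qed
    then show ?thesis using False by simp
  qed
  finally show ?thesis by (simp add: flips_def)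
qed

end

end

section \<open>Characters of the centralizer of a permutation\<close>

lemma (in comm_group) pow_cong:
  assumes a: "a \<in> carrier G" and "a [^] (m :: nat) = \<one>" and "[k = l] (mod m)"
  shows "a [^] k = a [^] l"
proof -
  have "a [^] k = a [^] (k mod m)" for k
  proof -
    have "a [^] k = a [^] (m * (k div m) + k mod m)" by simp
    also have "\<dots> = (a [^] m) [^] (k div m) \<otimes> a [^] (k mod m)"
      using a by (simp only: nat_pow_mult nat_pow_pow)
    finally show ?thesis using assms by simp
  qed
  from this[of k] this[of l] show ?thesis using assms(3) by (simp add: cong_def)
qed

context finite_permutation
begin

definition sizes :: "nat set" where "sizes = period ` S"
text \<open>At each length \<open>i\<close> one cycle is chosen, and a second one if there are several; a character will
be determined by its values at the rotation of the first and at the exchange of the two.\<close>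

definition orbit1 :: "nat \<Rightarrow> 'a set" where "orbit1 i = (SOME A. A \<in> orbits_of_size i)"
definition orbit2 :: "nat \<Rightarrow> 'a set" where "orbit2 i = (SOME A. A \<in> orbits_of_size i \<and> A \<noteq> orbit1 i)"
definition repeated :: "nat \<Rightarrow> bool" where "repeated i \<longleftrightarrow> 2 \<le> card (orbits_of_size i)"

lemma finite_sizes: "finite sizes"
  using fin by (simp add: sizes_def)

lemma orbit1: assumes "i \<in> sizes" shows "orbit1 i \<in> orbits" "card (orbit1 i) = i"
proof -
  have "\<exists>A. A \<in> orbits_of_size i" using assms by (auto simp: sizes_def orbits_of_size_def orbits_def)
  from someI_ex[OF this] show "orbit1 i \<in> orbits" "card (orbit1 i) = i"
    unfolding orbit1_def by (auto simp: orbits_of_size_def)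
qed

lemma orbit2:
  assumes "repeated i" shows "orbit2 i \<in> orbits" "card (orbit2 i) = i" "orbit1 i \<noteq> orbit2 i"
proof -
  have "card {orbit1 i} < card (orbits_of_size i)" using assms by (simp add: repeated_def)
  then have "\<not> orbits_of_size i \<subseteq> {orbit1 i}" using card_mono[of "{orbit1 i}" "orbits_of_size i"] by auto
  then have "\<exists>A. A \<in> orbits_of_size i \<and> A \<noteq> orbit1 i" by blast
  from someI_ex[OF this, folded orbit2_def]
  have *: "orbit2 i \<in> orbits_of_size i" "orbit2 i \<noteq> orbit1 i" by blast+
  from *(1) show "orbit2 i \<in> orbits" "card (orbit2 i) = i" unfolding orbits_of_size_def by blast+
  from *(2) show "orbit1 i \<noteq> orbit2 i" by (rule not_sym)
qed

lemma repeated_if_swappable: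
  assumes "swappable x y" shows "repeated (period x)"
proof -
  have "{orb x, orb y} \<subseteq> orbits_of_size (period x)" "orb x \<noteq> orb y"
    using assms orb_eq_iff[of y x] by (auto simp: swappable_def orbits_of_size_def orbits_def)
  then show ?thesis
    unfolding repeated_def using card_mono[OF finite_orbits_of_size, of "{orb x, orb y}"] by (simp add: numeral_2_eq_2)
qed

definition point1 :: "nat \<Rightarrow> 'a" where "point1 i = base (orbit1 i)"
definition point2 :: "nat \<Rightarrow> 'a" where "point2 i = base (orbit2 i)"

lemma point1: assumes "i \<in> sizes" shows "point1 i \<in> S" "period (point1 i) = i"
  unfolding point1_def base_orb(3)[OF orbit1(1)[OF assms]]
  by (rule base_orb(2)[OF orbit1(1)[OF assms]], rule orbit1(2)[OF assms])

lemma repeated_sizes: "repeated i \<Longrightarrow> i \<in> sizes"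
proof -
  assume "repeated i"
  then obtain x where "x \<in> S" "orbit2 i = orb x" "card (orbit2 i) = i"
    using orbit2(1,2) unfolding orbits_def by blast
  then show ?thesis unfolding sizes_def by (metis imageI)
qed

lemma swappable_points: assumes "repeated i" shows "swappable (point1 i) (point2 i)"
  unfolding point1_def point2_def
proof (rule swappable_base)
  note o = orbit1[OF repeated_sizes[OF assms]] orbit2[OF assms]
  show "orbit1 i \<in> orbits" "orbit2 i \<in> orbits" "orbit1 i \<noteq> orbit2 i" by (fact o)+
  show "card (orbit1 i) = card (orbit2 i)" unfolding o(2) o(4) ..
qed

end

locale finite_permutation_characters = finite_permutation S \<sigma> + M: comm_group M
  for S :: "'a set" and \<sigma> and M :: "('f, 'c) monoid_scheme" (structure)
begin

definition chars :: "(('a \<Rightarrow> 'a) \<Rightarrow> 'f) set" where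
  "chars = {\<chi> \<in> extensional cent. (\<forall>z\<in>cent. \<chi> z \<in> carrier M) \<and>
     (\<forall>z\<in>cent. \<forall>w\<in>cent. \<chi> (z \<circ> w) = \<chi> z \<otimes> \<chi> w)}"

definition roots_of_one :: "nat \<Rightarrow> 'f set" where
  "roots_of_one m = {a \<in> carrier M. a [^] m = \<one>}"

text \<open>A rotation of a cycle of length \<open>i\<close> has order \<open>i\<close> and an exchange of two cycles has order 2. If
there is no exchange at length \<open>i\<close>, the second entry is the dummy value \<open>\<one>\<close>, as in
\<open>datum\<close>.\<close>

definition value_set :: "nat \<Rightarrow> ('f \<times> 'f) set" where
  "value_set i = roots_of_one i \<times> (if repeated i then roots_of_one 2 else {\<one>})"

definition datum :: "(('a \<Rightarrow> 'a) \<Rightarrow> 'f) \<Rightarrow> nat \<Rightarrow> 'f \<times> 'f" where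
  "datum \<chi> = (\<lambda>i\<in>sizes. (\<chi> (rot (point1 i)),
     if repeated i then \<chi> (swap (point1 i) (point2 i)) else \<one>))"

definition character_of :: "(nat \<Rightarrow> 'f \<times> 'f) \<Rightarrow> ('a \<Rightarrow> 'a) \<Rightarrow> 'f" where
  "character_of t = (\<lambda>z\<in>cent. \<Otimes>i\<in>sizes. fst (t i) [^] turns i z \<otimes> snd (t i) [^] flips i z)"

lemma charsD:
  assumes "\<chi> \<in> chars"
  shows "z \<in> cent \<Longrightarrow> \<chi> z \<in> carrier M"
    "z \<in> cent \<Longrightarrow> w \<in> cent \<Longrightarrow> \<chi> (z \<circ> w) = \<chi> z \<otimes> \<chi> w" "\<chi> \<in> extensional cent"
proof -
  note * = assms[unfolded chars_def mem_Collect_eq]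
  show "z \<in> cent \<Longrightarrow> \<chi> z \<in> carrier M"
    by (rule bspec[OF conjunct1[OF conjunct2[OF *]]])
  show "z \<in> cent \<Longrightarrow> w \<in> cent \<Longrightarrow> \<chi> (z \<circ> w) = \<chi> z \<otimes> \<chi> w"
    by (rule bspec[OF bspec[OF conjunct2[OF conjunct2[OF *]]]])
  show "\<chi> \<in> extensional cent" by (rule conjunct1[OF *])
qed

lemma chars_id: assumes "\<chi> \<in> chars" shows "\<chi> id = \<one>"
proof -
  have "\<chi> id \<otimes> \<chi> id = \<chi> id"
    using charsD(2)[OF assms id_in_cent id_in_cent] unfolding comp_id by (rule sym)
  then show ?thesis using charsD(1)[OF assms id_in_cent] by simp
qed

lemma chars_funpow: "\<chi> \<in> chars \<Longrightarrow> z \<in> cent \<Longrightarrow> \<chi> (z ^^ k) = \<chi> z [^] k"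
proof (induction k)
  case 0
  then show ?case using chars_id by (simp add: id_def)
next
  case (Suc k)
  then have "\<chi> (z \<circ> z ^^ k) = \<chi> z \<otimes> \<chi> z [^] k" using charsD(2) funpow_in_cent by metis
  also have "\<dots> = \<chi> z [^] Suc k" using charsD(1)[OF Suc.prems] M.nat_pow_Suc2 by metis
  finally show ?case by (simp only: funpow.simps)
qed

lemma chars_conj:
  assumes \<chi>: "\<chi> \<in> chars" and cent: "z \<in> cent" "v \<in> cent" "w \<in> cent" and eq: "z \<circ> v = w \<circ> z"
  shows "\<chi> v = \<chi> w"
proof -
  have "\<chi> z \<otimes> \<chi> v = \<chi> w \<otimes> \<chi> z" using charsD(2)[OF \<chi>] cent eq by metis
  then show ?thesis using charsD(1)[OF \<chi>] cent by (simp add: M.m_comm)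
qed

lemma chars_rot:
  assumes \<chi>: "\<chi> \<in> chars" and xy: "x \<in> S" "y \<in> S" "period x = period y"
  shows "\<chi> (rot x) = \<chi> (rot y)"
proof -
  obtain z where z: "z \<in> cent" "z x = y" using ex_cent_moving[OF xy] by blast
  show ?thesis
    using chars_conj[OF \<chi> z(1) rot_in_cent[OF xy(1)] rot_in_cent[OF xy(2)]] rot_conj[OF z(1), of x]
    unfolding z(2) by blast
qed

lemma chars_swap:
  assumes \<chi>: "\<chi> \<in> chars" and 1: "swappable x y" and 2: "swappable x' y'" and "period x = period x'"
  shows "\<chi> (swap x y) = \<chi> (swap x' y')"
proof -
  obtain z where z: "z \<in> cent" "z x = x'" "z y = y'" using ex_cent_moving_pair[OF assms(2-4)] by blast
  show ?thesis
    using chars_conj[OF \<chi> z(1) swap_in_cent[OF 1] swap_in_cent[OF 2]] swap_conj[OF z(1) 1]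
    unfolding z(2,3) by blast
qed

lemma datum_in_value_set:
  assumes \<chi>: "\<chi> \<in> chars" shows "datum \<chi> \<in> (\<Pi>\<^sub>E i\<in>sizes. value_set i)"
proof -
  have "\<chi> (rot (point1 i)) \<in> roots_of_one i" if i: "i \<in> sizes" for i
  proof -
    have "\<chi> (rot (point1 i)) [^] i = \<chi> (rot (point1 i) ^^ i)"
      using chars_funpow[OF \<chi> rot_in_cent] point1(1)[OF i] by simp
    also have "\<dots> = \<one>" using rot_funpow_period[of "point1 i" i] point1(2)[OF i] chars_id[OF \<chi>] by simp
    finally show ?thesis using charsD(1)[OF \<chi> rot_in_cent] point1(1)[OF i] by (simp add: roots_of_one_def)
  qed
  moreover have "\<chi> (swap (point1 i) (point2 i)) \<in> roots_of_one 2" if i: "repeated i" for i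
  proof -
    note sw = swappable_points[OF i]
    let ?s = "swap (point1 i) (point2 i)"
    have "?s ^^ 2 = id" using swap_swap[OF sw] by (simp add: numeral_2_eq_2 fun_eq_iff)
    then have "\<chi> ?s [^] (2 :: nat) = \<one>"
      using chars_funpow[OF \<chi> swap_in_cent[OF sw], of 2] chars_id[OF \<chi>] by simp
    then show ?thesis using charsD(1)[OF \<chi> swap_in_cent[OF sw]] by (simp add: roots_of_one_def)
  qed
  ultimately show ?thesis by (auto simp: datum_def value_set_def)
qed

text \<open>A character agrees on conjugate elements, so its values at the chosen rotations and exchanges
determine those at all generators.\<close>

lemma inj_on_datum: "inj_on datum chars"
proof (rule inj_onI)
  fix \<chi> \<chi>' assume \<chi>: "\<chi> \<in> chars" and \<chi>': "\<chi>' \<in> chars" and eq: "datum \<chi> = datum \<chi>'"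
  have "\<chi> z = \<chi>' z" if "z \<in> cent" for z
    using that
  proof (induction z rule: cent_induct)
    case id
    show ?case unfolding chars_id[OF \<chi>] chars_id[OF \<chi>'] ..
  next
    case (rot x w)
    have i: "period x \<in> sizes" using rot by (simp add: sizes_def)
    have "\<chi> (rot (point1 (period x))) = \<chi>' (rot (point1 (period x)))"
      using fun_cong[OF eq, of "period x"] i by (simp add: datum_def)
    then have "\<chi> (rot x) = \<chi>' (rot x)"
      using chars_rot[of _ "point1 (period x)" x] \<chi> \<chi>' point1[OF i] rot(1) by metis
    then show ?case using rot charsD(2) \<chi> \<chi>' rot_in_cent by metis
  next
    case (swap x y w)
    note i = repeated_if_swappable[OF swap(1)]
    have "\<chi> (swap (point1 (period x)) (point2 (period x))) =
          \<chi>' (swap (point1 (period x)) (point2 (period x)))"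
      using fun_cong[OF eq, of "period x"] i repeated_sizes[OF i] by (simp add: datum_def)
    then have "\<chi> (swap x y) = \<chi>' (swap x y)"
      using chars_swap[OF _ swappable_points[OF i] swap(1)] \<chi> \<chi>' point1(2)[OF repeated_sizes[OF i]] by metis
    then show ?case using swap charsD(2) \<chi> \<chi>' swap_in_cent by metis
  qed
  then show "\<chi> = \<chi>'" using charsD(3) \<chi> \<chi>' extensionalityI by metis
qed

context
  fixes t assumes t: "t \<in> (\<Pi>\<^sub>E i\<in>sizes. value_set i)"
begin

lemma t_root:
  assumes "i \<in> sizes"
  shows "fst (t i) \<in> carrier M" "fst (t i) [^] i = \<one>"
    "snd (t i) \<in> carrier M" "snd (t i) [^] (2 :: nat) = \<one>" "\<not> repeated i \<Longrightarrow> snd (t i) = \<one>"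
proof -
  have "t i \<in> value_set i" using t assms by auto
  then show "fst (t i) \<in> carrier M" "fst (t i) [^] i = \<one>"
    "snd (t i) \<in> carrier M" "snd (t i) [^] (2 :: nat) = \<one>" "\<not> repeated i \<Longrightarrow> snd (t i) = \<one>"
    by (auto simp: value_set_def roots_of_one_def split: if_splits)
qed

text \<open>This is well defined on exponents that are additive only modulo \<open>i\<close> and 2, as the bases are
roots of unity whose orders divide these numbers.\<close>

lemma character_of_in_chars: "character_of t \<in> chars"
proof -
  define f where "f i z = fst (t i) [^] turns i z \<otimes> snd (t i) [^] flips i z" for i z
  have f: "f i z \<in> carrier M" if "i \<in> sizes" for i z
    using t_root[OF that] by (simp add: f_def)
  have "f i (z \<circ> w) = f i z \<otimes> f i w" if i: "i \<in> sizes" and zw: "z \<in> cent" "w \<in> cent" for i z w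
  proof -
    note [simp] = t_root(1,3)[OF i]
    have "fst (t i) [^] turns i (z \<circ> w) = fst (t i) [^] turns i z \<otimes> fst (t i) [^] turns i w"
      using M.pow_cong[OF t_root(1,2)[OF i] turns_comp[OF zw]] by (simp add: M.nat_pow_mult)
    moreover have "snd (t i) [^] flips i (z \<circ> w) = snd (t i) [^] flips i z \<otimes> snd (t i) [^] flips i w"
      using M.pow_cong[OF t_root(3,4)[OF i] flips_comp[OF zw]] by (simp add: M.nat_pow_mult)
    ultimately show ?thesis by (simp add: f_def M.m_ac)
  qed
  then have "(\<Otimes>i\<in>sizes. f i (z \<circ> w)) = (\<Otimes>i\<in>sizes. f i z) \<otimes> (\<Otimes>i\<in>sizes. f i w)"
    if "z \<in> cent" "w \<in> cent" for z w
  proof -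
    have "(\<Otimes>i\<in>sizes. f i (z \<circ> w)) = (\<Otimes>i\<in>sizes. f i z \<otimes> f i w)"
      using f that \<open>\<And>w z i. \<lbrakk>i \<in> sizes; z \<in> cent; w \<in> cent\<rbrakk> \<Longrightarrow> f i (z \<circ> w) = f i z \<otimes> f i w\<close>
      by (intro M.finprod_cong') auto
    then show ?thesis using f by (simp add: M.finprod_multf)
  qed
  then show ?thesis
    using f comp_in_cent unfolding character_of_def f_def[symmetric] by (auto simp: chars_def)
qed

lemma datum_character_of: "datum (character_of t) = t"
proof
  fix j
  show "datum (character_of t) j = t j"
  proof (cases "j \<in> sizes")
    case j: True
    \<comment> \<open>All factors but that of \<open>j\<close> become trivial.\<close>
    have single: "(\<Otimes>i\<in>sizes. if j = i then a i else \<one>) = a j" if "\<And>i. i \<in> sizes \<Longrightarrow> a i \<in> carrier M" for a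
      using that by (intro M.finprod_singleton j finite_sizes) auto
    have "character_of t (rot (point1 j)) =
        (\<Otimes>i\<in>sizes. fst (t i) [^] turns i (rot (point1 j)) \<otimes> snd (t i) [^] flips i (rot (point1 j)))"
      using rot_in_cent[OF point1(1)[OF j]] by (simp add: character_of_def)
    also have "\<dots> = (\<Otimes>i\<in>sizes. if j = i then fst (t i) else \<one>)"
    proof (rule M.finprod_cong'[OF refl])
      fix i assume i: "i \<in> sizes"
      note [simp] = t_root(1,3)[OF i]
      have "fst (t i) [^] turns i (rot (point1 j)) = fst (t i) [^] (if i = j then 1 else 0 :: nat)"
        using M.pow_cong[OF t_root(1,2)[OF i] turns_rot[OF point1(1)[OF j]]] point1(2)[OF j] by simp
      then show "fst (t i) [^] turns i (rot (point1 j)) \<otimes> snd (t i) [^] flips i (rot (point1 j)) =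
          (if j = i then fst (t i) else \<one>)"
        using flips_rot[OF point1(1)[OF j]] by simp
    qed (use t_root in auto)
    also have "\<dots> = fst (t j)" using t_root by (intro single) auto
    finally have 1: "character_of t (rot (point1 j)) = fst (t j)" .
    have 2: "character_of t (swap (point1 j) (point2 j)) = snd (t j)" if rep: "repeated j"
    proof -
      let ?s = "swap (point1 j) (point2 j)"
      have card: "card (orbit1 j) = card (orbit2 j)" using orbit1[OF j] orbit2[OF rep] by simp
      note o = orbit1(1)[OF j] orbit2(1,3)[OF rep] card
      have "character_of t ?s = (\<Otimes>i\<in>sizes. fst (t i) [^] turns i ?s \<otimes> snd (t i) [^] flips i ?s)"
        using swap_in_cent[OF swappable_points[OF rep]] by (simp add: character_of_def)
      also have "\<dots> = (\<Otimes>i\<in>sizes. if j = i then snd (t i) else \<one>)"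
      proof (rule M.finprod_cong'[OF refl])
        fix i assume i: "i \<in> sizes"
        note [simp] = t_root(1,3)[OF i]
        have "fst (t i) [^] turns i ?s = fst (t i) [^] (0 :: nat)"
          using M.pow_cong[OF t_root(1,2)[OF i] turns_swap[OF o]] by (simp add: point1_def point2_def)
        moreover have "flips i ?s = (if i = j then 1 else 0)"
          using flips_swap[OF o] orbit1(2)[OF j] by (simp add: point1_def point2_def)
        ultimately show "fst (t i) [^] turns i ?s \<otimes> snd (t i) [^] flips i ?s = (if j = i then snd (t i) else \<one>)"
          by simp
      qed (use t_root in auto)
      also have "\<dots> = snd (t j)" using t_root by (intro single) auto
      finally show ?thesis .
    qed
    show ?thesis using 1 2 t_root(5)[OF j] j by (simp add: datum_def prod_eq_iff)
  next
    case False
    then show ?thesis using t by (simp add: datum_def PiE_def extensional_def)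
  qed
qed

end

theorem card_chars: "card chars = (\<Prod>i\<in>sizes. card (roots_of_one i) * (if repeated i then card (roots_of_one 2) else 1))"
proof -
  have "datum ` chars = (\<Pi>\<^sub>E i\<in>sizes. value_set i)"
  proof
    show "datum ` chars \<subseteq> (\<Pi>\<^sub>E i\<in>sizes. value_set i)"
      using datum_in_value_set by (rule image_subsetI)
    show "(\<Pi>\<^sub>E i\<in>sizes. value_set i) \<subseteq> datum ` chars"
    proof
      fix t assume t: "t \<in> (\<Pi>\<^sub>E i\<in>sizes. value_set i)"
      show "t \<in> datum ` chars"
        using datum_character_of[OF t, symmetric] character_of_in_chars[OF t] by (rule image_eqI)
    qed
  qed
  then have "card chars = card (\<Pi>\<^sub>E i\<in>sizes. value_set i)"
    using card_image[OF inj_on_datum] by simp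
  also have "\<dots> = (\<Prod>i\<in>sizes. card (value_set i))"
    by (rule card_PiE[OF finite_sizes])
  also have "\<dots> = (\<Prod>i\<in>sizes. card (roots_of_one i) * (if repeated i then card (roots_of_one 2) else 1))"
    by (rule prod.cong) (simp_all add: value_set_def card_cartesian_product)
  finally show ?thesis .
qed

end

section \<open>Ramification systems of the symmetric group\<close>

lemma sym_group_automorphism_inner:
  assumes "n \<noteq> 6" and \<phi>: "\<phi> \<in> iso (sym_group n) (sym_group n)"
  shows "\<exists>k\<in>carrier (sym_group n). \<forall>x\<in>carrier (sym_group n).
           \<phi> x = k \<otimes>\<^bsub>sym_group n\<^esub> x \<otimes>\<^bsub>sym_group n\<^esub> inv\<^bsub>sym_group n\<^esub> k"
proof -
  have car: "carrier (sym_group n) = {p. p permutes {1..n}}" by (simp add: sym_group_def)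
  interpret sym_automorphism "{1..n}" \<phi>
    by unfold_locales (use \<phi> in \<open>auto simp: iso_def hom_def sym_group_def\<close>)
  obtain k where k: "k permutes {1..n}" "\<And>p. p permutes {1..n} \<Longrightarrow> \<phi> p = k \<circ> p \<circ> inv' k"
    using inner assms(1) by auto
  have kc: "k \<in> carrier (sym_group n)" using k(1) by (simp add: car)
  show ?thesis
    by (rule bexI[OF _ kc]) (simp add: sym_group_inv_equality[OF kc] sym_group_mult car k(2))
qed

text \<open>The hypothesis on roots of unity makes the numbers of roots in \<open>card_chars\<close> as large as possible,
namely \<open>i\<close> and 2.\<close>

lemma gamma_sym_group:
  assumes F: "field F" and C: "C \<in> conj_classes (sym_group n)" and \<sigma>: "\<sigma> \<in> C"
    and roots: "has_enough_roots F n \<sigma>"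
  shows "gamma F (sym_group n) C =
     (\<Prod>i | i \<in> {1..n} \<and> num_cycles n \<sigma> i = 1. i) *
     (\<Prod>i | i \<in> {1..n} \<and> num_cycles n \<sigma> i \<ge> 2. 2 * i)"
proof -
  interpret F: field F by (rule F)
  interpret G: group_field "sym_group n" F
    by (intro group_field.intro sym_group_is_group F)
  let ?G = "sym_group n"
  have \<sigma>G: "\<sigma> \<in> carrier ?G" by (rule G.conj_class_closed(1)[OF C \<sigma>])
  have fp: "finite_permutation {1..n} \<sigma>"
    using \<sigma>G by (intro finite_permutation.intro) (simp_all add: sym_group_carrier)
  have comm: "comm_group (Multiplicative_Group.mult_of F)"
    unfolding F.mult_of_is_Units by (rule F.units_comm_group)
  interpret P: finite_permutation_characters "{1..n}" \<sigma> "Multiplicative_Group.mult_of F"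
    by (intro finite_permutation_characters.intro fp comm)
  have cent: "centralizer ?G \<sigma> = P.cent"
    unfolding centralizer_def P.cent_def sym_group_def by auto
  have chars: "characters F ?G (centralizer ?G \<sigma>) = P.chars"
    unfolding cent characters_def P.chars_def hom_def by (auto simp: sym_group_def)
  have num: "num_cycles n \<sigma> i = card (P.orbits_of_size i)" for i
    unfolding num_cycles_def P.orbits_of_size_def P.orbits_def ..
  have rep: "P.repeated i \<longleftrightarrow> num_cycles n \<sigma> i \<ge> 2" for i
    unfolding num P.repeated_def ..
  have sizes_iff: "i \<in> P.sizes \<longleftrightarrow> i \<in> {1..n} \<and> num_cycles n \<sigma> i \<ge> 1" for i
  proof
    assume "i \<in> P.sizes"
    then obtain x where x: "x \<in> {1..n}" "i = card (Orbits.orbit \<sigma> x)"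
      unfolding P.sizes_def by blast
    have "P.orbits_of_size i \<noteq> {}" using x unfolding P.orbits_of_size_def P.orbits_def by blast
    then have "num_cycles n \<sigma> i \<ge> 1"
      using P.finite_orbits_of_size[of i] by (simp add: num Suc_le_eq card_gt_0_iff)
    moreover have "i \<le> n" using card_mono[OF _ P.orb_subset[OF x(1)]] x by simp
    moreover have "i \<ge> 1" using P.period_pos[of x] x by simp
    ultimately show "i \<in> {1..n} \<and> num_cycles n \<sigma> i \<ge> 1" by simp
  next
    assume "i \<in> {1..n} \<and> num_cycles n \<sigma> i \<ge> 1"
    then have "card (P.orbits_of_size i) \<noteq> 0" by (simp add: num)
    then obtain A where "A \<in> P.orbits_of_size i" by (metis card.empty ex_in_conv)
    then show "i \<in> P.sizes" unfolding P.orbits_of_size_def P.orbits_def P.sizes_def by blast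
  qed
  obtain g where g: "g \<in> carrier ?G" "g \<otimes>\<^bsub>?G\<^esub> \<sigma> \<otimes>\<^bsub>?G\<^esub> inv\<^bsub>?G\<^esub> g = G.class_rep C"
    using G.conj_class_transitive[OF C \<sigma> G.class_rep_in[OF C]] by blast
  have "gamma F ?G C = card P.chars"
    using G.card_characters_conj[OF \<sigma>G g(1)] unfolding g(2) chars gamma_def G.class_rep_def .
  also have "\<dots> = (\<Prod>i\<in>P.sizes. i * (if P.repeated i then 2 else 1))"
    unfolding P.card_chars
  proof (rule prod.cong[OF refl])
    fix i assume "i \<in> P.sizes"
    then have i: "i \<in> {1..n}" "num_cycles n \<sigma> i \<ge> 1" using sizes_iff by auto
    then have i0: "i > 0" by simp
    have "\<exists>z. primitive_root F i z"
      using conjunct1[OF roots[unfolded has_enough_roots_def]] i by simp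
    then have "card (P.roots_of_one i) = i"
      unfolding P.roots_of_one_def using F.card_roots_of_unity[OF _ i0] by (elim exE)
    moreover have "card (P.roots_of_one 2) = 2" if "P.repeated i"
    proof -
      have "\<exists>z. primitive_root F 2 z"
        using conjunct2[OF roots[unfolded has_enough_roots_def]] i(1) that rep by metis
      then show ?thesis
        unfolding P.roots_of_one_def using F.card_roots_of_unity[of 2] by (elim exE) simp
    qed
    ultimately show "card (P.roots_of_one i) * (if P.repeated i then card (P.roots_of_one 2) else 1) =
        i * (if P.repeated i then 2 else 1)" by simp
  qed
  also have "\<dots> = (\<Prod>i\<in>{i \<in> {1..n}. num_cycles n \<sigma> i = 1}. i) *
      (\<Prod>i\<in>{i \<in> {1..n}. num_cycles n \<sigma> i \<ge> 2}. 2 * i)" (is "_ = prod _ ?A * prod _ ?B")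
  proof -
    have sizes: "P.sizes = ?A \<union> ?B" by (auto simp: set_eq_iff sizes_iff simp del: One_nat_def)
    have "(\<Prod>i\<in>P.sizes. i * (if P.repeated i then 2 else 1)) =
        (\<Prod>i\<in>?A. i * (if P.repeated i then 2 else 1)) * (\<Prod>i\<in>?B. i * (if P.repeated i then 2 else 1))"
      unfolding sizes by (rule prod.union_disjoint) auto
    also have "(\<Prod>i\<in>?A. i * (if P.repeated i then 2 else 1)) = (\<Prod>i\<in>?A. i)"
      unfolding rep by (rule prod.cong[OF refl]) simp
    also have "(\<Prod>i\<in>?B. i * (if P.repeated i then 2 else 1)) = (\<Prod>i\<in>?B. 2 * i)"
      unfolding rep by (rule prod.cong[OF refl]) simp
    finally show ?thesis .
  qed
  finally show ?thesis .
qed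

theorem theorem2p19:
  fixes n :: nat
    and F :: "('f, 'c) ring_scheme"
    and r :: "(nat \<Rightarrow> nat) set \<Rightarrow> nat"
    and I :: "(nat \<Rightarrow> nat) set \<Rightarrow> 'i set"
  assumes "n \<ge> 1" and "n \<noteq> 6"
    and "field F"
    and "\<exists>z. primitive_root F n z"
    and "r \<in> ramifications (sym_group n)"
    and "index_sets (sym_group n) r I"
  shows "num_RSC_classes F I (sym_group n) r =
           (\<Prod>C \<in> ramified_classes (sym_group n) r.
              (gamma F (sym_group n) C + r C - 1) choose (r C)) \<and>
         (\<forall>C \<in> conj_classes (sym_group n). \<forall>\<sigma> \<in> C. has_enough_roots F n \<sigma> \<longrightarrow>
            gamma F (sym_group n) C =
              (\<Prod>i | i \<in> {1..n} \<and> num_cycles n \<sigma> i = 1. i) *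
              (\<Prod>i | i \<in> {1..n} \<and> num_cycles n \<sigma> i \<ge> 2. 2 * i))"
proof (intro conjI ballI impI)
  have fin: "finite (carrier (sym_group n))"
    by (simp add: sym_group_def finite_permutations)
  interpret inner_group_field "sym_group n" F r I
    using assms sym_group_automorphism_inner fin
    by (intro inner_group_field.intro inner_group_field_axioms.intro group_field.intro
        sym_group_is_group) auto
  show "num_RSC_classes F I (sym_group n) r =
      (\<Prod>C \<in> ramified_classes (sym_group n) r. (gamma F (sym_group n) C + r C - 1) choose (r C))"
    by (rule num_RSC_classes_eq)
qed (rule gamma_sym_group[OF assms(3)])

end
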